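(* Suppose a system of congruences on $A_1,\dots,A_r$ has the following property: there is a free group $F$ on $m$ generators $f_1,\dots,f_m$ (for some finite $m$) such that there are pairwise disjoint nonempty finite subsets of $F$ satisfying the congruences (with respect to the action of $F$ on itself by left multiplication), and the union of these finite sets is connected and prime. Then, for any suitable space $(\mathcal{X},G)$, there are nonempty pairwise disjoint open subsets of $\mathcal{X}$ with dense union which satisfy the congruences.
   Context: Fix a positive integer $r$. A congruence on $A_1,\dots,A_r$ is a formal expression $\bigcup_{k\in L}A_k\cong\bigcup_{k\in R}A_k$, specified by a pair of subsets $L,R\subseteq\{1,\dots,r\}$. A system of congruences is a finite list of such congruences, given by pairs $(L_i,R_i)$. If a group $G$ acts on a set $X$, a sequence of subsets $A_1,\dots,A_r$ of $X$ satisfies the system if the sets $A_k$ are pairwise disjoint and, for each $i$, there is $\sigma_i\in G$ with $\sigma_i(\bigcup_{k\in L_i}A_k)=\bigcup_{k\in R_i}A_k$ (the sets need not cover $X$). A suitable space is a pair $(\mathcal{X},G)$ where $\mathcal{X}$ is a nonempty complete separable metric space and $G$ is a countable group acting on $\mathcal{X}$ by homeomorphisms such that $G$ is a free group on more than one generator and $G$ acts freely on a comeager subset of $\mathcal{X}$ (equivalently, for each $g\in G$ other than the identity, the set of fixed points of $g$ has empty interior). Let $F$ be freely generated by $f_1,\dots,f_m$. For $g,g'\in F$ there is a unique shortest path from $g$ to $g'$ via the generators and their inverses, i.e., a shortest sequence $g_0=g,g_1,\dots,g_k=g'$ where each $g_{j+1}$ is obtained from $g_j$ by multiplying on the left by a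 single $f_i$ or $f_i^{-1}$. A subset $S$ of $F$ is connected if, for all $g,g'\in S$, all group elements along the shortest path from $g$ to $g'$ are in $S$. If $S$ is a finite subset of $F$, $g\in S$ and $i\le m$, let $k\ge0$ be greatest such that $f_i^jg\in S$ for $0\le j\le k$, and let $k'\le0$ be smallest such that $f_i^jg\in S$ for $k'\le j\le0$. The set $\{f_i^jg: k'\le j\le k\}$ is a line in the $i$-direction for $S$ (for each fixed $i$, these lines partition $S$). The set $S$ is prime if, for each $i\le m$, the cardinalities of the lines in the $i$-direction for $S$ have no common factor greater than $1$. *)

theory Defs
  imports "HOL-Analysis.Analysis" "HOL-Algebra.Group_Action"
begin

text \<open>
  A letter is a pair \<open>(i, b)\<close>, standing for the generator \<open>f i\<close> if \<open>b\<close> holds and for its inverse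
  otherwise. A group is freely generated by the family \<open>f\<close> over \<open>I\<close> if each of its elements is the
  value of exactly one reduced word; in particular \<open>f\<close> is then injective on \<open>I\<close>.
\<close>

definition letter :: "('g, 'b) monoid_scheme \<Rightarrow> ('i \<Rightarrow> 'g) \<Rightarrow> 'i \<times> bool \<Rightarrow> 'g" where
  "letter G f l = (if snd l then f (fst l) else inv\<^bsub>G\<^esub> f (fst l))"

definition word_value :: "('g, 'b) monoid_scheme \<Rightarrow> ('i \<Rightarrow> 'g) \<Rightarrow> ('i \<times> bool) list \<Rightarrow> 'g" where
  "word_value G f w = foldr (\<lambda>l x. letter G f l \<otimes>\<^bsub>G\<^esub> x) w \<one>\<^bsub>G\<^esub>"

definition reduced_word :: "('i \<times> bool) list \<Rightarrow> bool" where
  "reduced_word w \<longleftrightarrow> successively (\<lambda>l l'. fst l = fst l' \<longrightarrow> snd l = snd l') w"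

definition freely_generated :: "('g, 'b) monoid_scheme \<Rightarrow> 'i set \<Rightarrow> ('i \<Rightarrow> 'g) \<Rightarrow> bool" where
  "freely_generated G I f \<longleftrightarrow>
     group G \<and> f ` I \<subseteq> carrier G \<and>
     (\<forall>g\<in>carrier G. \<exists>!w. fst ` set w \<subseteq> I \<and> reduced_word w \<and> word_value G f w = g)"

text \<open>
  The congruence \<open>(L, R)\<close> is the expression \<open>(\<Union>k\<in>L. A k) \<cong> (\<Union>k\<in>R. A k)\<close>. In \<open>satisfies\<close>,
  the function \<open>\<phi>\<close> is the action of \<open>G\<close>.
\<close>

type_synonym congruence_spec = "nat set \<times> nat set"

definition congruence_system :: "nat \<Rightarrow> congruence_spec list \<Rightarrow> bool" where
  "congruence_system r sys \<longleftrightarrow> (\<forall>(L, R)\<in>set sys. L \<subseteq> {1..r} \<and> R \<subseteq> {1..r})"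

definition satisfies ::
  "('g, 'b) monoid_scheme \<Rightarrow> ('g \<Rightarrow> 'x \<Rightarrow> 'x) \<Rightarrow> nat \<Rightarrow> congruence_spec list \<Rightarrow> (nat \<Rightarrow> 'x set) \<Rightarrow> bool"
where
  "satisfies G \<phi> r sys A \<longleftrightarrow>
     (\<forall>j\<in>{1..r}. \<forall>k\<in>{1..r}. j \<noteq> k \<longrightarrow> A j \<inter> A k = {}) \<and>
     (\<forall>(L, R)\<in>set sys. \<exists>\<sigma>\<in>carrier G. \<phi> \<sigma> ` (\<Union>k\<in>L. A k) = (\<Union>k\<in>R. A k))"

definition comeager :: "'x::topological_space set \<Rightarrow> bool" where
  "comeager D \<longleftrightarrow>
     (\<exists>\<U>. countable \<U> \<and> (\<forall>U\<in>\<U>. open U \<and> closure U = UNIV) \<and> \<Inter>\<U> \<subseteq> D)"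

text \<open>
  The nonempty complete separable metric space is the type \<open>'x\<close>. The free basis of \<open>G\<close> may be
  infinite.
\<close>

definition suitable_space ::
  "('g, 'b) monoid_scheme \<Rightarrow> ('g \<Rightarrow> 'x::polish_space \<Rightarrow> 'x) \<Rightarrow> bool"
where
  "suitable_space G \<phi> \<longleftrightarrow>
     countable (carrier G) \<and>
     (\<exists>B. freely_generated G B (\<lambda>b. b) \<and> (\<exists>a\<in>B. \<exists>b\<in>B. a \<noteq> b)) \<and>
     group_action G UNIV \<phi> \<and>
     (\<forall>g\<in>carrier G. \<exists>\<psi>. homeomorphism UNIV UNIV (\<phi> g) \<psi>) \<and>
     (\<exists>D. comeager D \<and> (\<forall>x\<in>D. \<forall>g\<in>carrier G. g \<noteq> \<one>\<^bsub>G\<^esub> \<longrightarrow> \<phi> g x \<noteq> x))"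

text \<open>
  A path from \<open>g\<close> to \<open>g'\<close> is the list of the group elements it visits, both ends included. Since
  the shortest path in a free group is unique, \<open>connected_subset\<close> may quantify over all of them.
\<close>

definition is_path ::
  "('f, 'b) monoid_scheme \<Rightarrow> nat \<Rightarrow> (nat \<Rightarrow> 'f) \<Rightarrow> 'f \<Rightarrow> 'f \<Rightarrow> 'f list \<Rightarrow> bool"
where
  "is_path F m f g g' p \<longleftrightarrow>
     p \<noteq> [] \<and> hd p = g \<and> last p = g' \<and>
     successively (\<lambda>x y. \<exists>i\<in>{1..m}. y = f i \<otimes>\<^bsub>F\<^esub> x \<or> y = inv\<^bsub>F\<^esub> f i \<otimes>\<^bsub>F\<^esub> x) p"

definition shortest_path ::
  "('f, 'b) monoid_scheme \<Rightarrow> nat \<Rightarrow> (nat \<Rightarrow> 'f) \<Rightarrow> 'f \<Rightarrow> 'f \<Rightarrow> 'f list \<Rightarrow> bool"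
where
  "shortest_path F m f g g' p \<longleftrightarrow>
     is_path F m f g g' p \<and> (\<forall>q. is_path F m f g g' q \<longrightarrow> length p \<le> length q)"

definition connected_subset ::
  "('f, 'b) monoid_scheme \<Rightarrow> nat \<Rightarrow> (nat \<Rightarrow> 'f) \<Rightarrow> 'f set \<Rightarrow> bool"
where
  "connected_subset F m f S \<longleftrightarrow>
     (\<forall>g\<in>S. \<forall>g'\<in>S. \<forall>p. shortest_path F m f g g' p \<longrightarrow> set p \<subseteq> S)"

text \<open>
  For \<open>S\<close> finite, \<open>g \<in> S\<close> and \<open>f i\<close> of infinite order, the two extrema below exist; \<open>line\<close> is only
  meant to be used in that situation.
\<close>

definition line :: "('f, 'b) monoid_scheme \<Rightarrow> (nat \<Rightarrow> 'f) \<Rightarrow> 'f set \<Rightarrow> nat \<Rightarrow> 'f \<Rightarrow> 'f set" where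
  "line F f S i g =
     (let k = (GREATEST k::int. 0 \<le> k \<and> (\<forall>j\<in>{0..k}. f i [^]\<^bsub>F\<^esub> j \<otimes>\<^bsub>F\<^esub> g \<in> S));
          k' = (LEAST k'::int. k' \<le> 0 \<and> (\<forall>j\<in>{k'..0}. f i [^]\<^bsub>F\<^esub> j \<otimes>\<^bsub>F\<^esub> g \<in> S))
      in (\<lambda>j::int. f i [^]\<^bsub>F\<^esub> j \<otimes>\<^bsub>F\<^esub> g) ` {k'..k})"

definition prime_subset ::
  "('f, 'b) monoid_scheme \<Rightarrow> nat \<Rightarrow> (nat \<Rightarrow> 'f) \<Rightarrow> 'f set \<Rightarrow> bool"
where
  "prime_subset F m f S \<longleftrightarrow>
     (\<forall>i\<in>{1..m}. \<not> (\<exists>d::nat. d > 1 \<and> (\<forall>g\<in>S. d dvd card (line F f S i g))))"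

end

theory Submission
  imports Defs "HOL-Library.Sublist"
begin

text \<open>
  The free group \<open>F\<close> embeds into \<open>G\<close>, hence acts on \<open>X\<close>, and it suffices to find an open \<open>V\<close> whose translates
  \<open>s V\<close>, for \<open>s\<close> in the union \<open>S\<close> of the given finite sets, are pairwise disjoint with dense union: then
  \<open>A k = (\<Union>s\<in>S k. s V)\<close> inherits every congruence. On each orbit, \<open>V\<close> selects a set of pairwise disjoint
  right translates of \<open>S\<close>, called tiles, in the Cayley tree of \<open>F\<close>.

  \<open>V\<close> is an increasing union of open sets, the \<open>n\<close>-th step making the tiles meet the \<open>n\<close>-th basic open set.
  At every stage the tiles form clusters (components in the tree) that are more than \<open>sep\<close> apart, and the covered set
  splits into uniformly bounded pieces more than \<open>wide\<close> apart. A new point is covered by a cluster that absorbs, nearest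
  first, all clusters within distance \<open>sep\<close>, the gap to each being covered exactly by tiles. A gap with a
  turn can always be covered exactly; a straight gap can if it is long, because the line lengths of \<open>S\<close> have no
  common factor. Near a point with free orbit the pattern is locally constant, and on a small open set the new cluster is
  repeated only at points that are very far apart in each orbit, which preserves the separation.
\<close>

section \<open>Reduced words and the tree metric of a free group\<close>

text \<open>Edges of the Cayley tree multiply on the left, so the tree metric is invariant under
  right multiplication: changing the base point of an orbit right-translates the pattern of tiles.
  Hence tiles are right translates of \<open>S\<close>, and all combinatorics takes place in
  \<open>F\<close>, which also serves points whose orbit is not free.

  Two obstacles shape the invariant. Tiles are never removed, and a short straight gap between
  clusters may admit no exact cover, so an uncovered point inside it could be lost for good.
  Therefore clusters are kept at a distance at which every straight gap can be filled, and whatever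
  comes too close is absorbed. But absorption could cascade without end, while only finitely many
  conditions on the translates of a point can be made constant on an open set. The bounded pieces,
  more than \<open>wide\<close> apart, confine a cascade to the pieces near the new point; their
  bound may grow from stage to stage, \<open>sep\<close> and \<open>wide\<close> stay fixed.

  Connectedness of \<open>S\<close> makes tiles subtrees, which meet a path in intervals, so a cover
  of a path can be planned in one dimension.\<close>

definition inv_letter :: "'i \<times> bool \<Rightarrow> 'i \<times> bool" where
  "inv_letter l = (fst l, \<not> snd l)"

lemma inv_letter_simps [simp]:
  "inv_letter (inv_letter l) = l" "fst (inv_letter l) = fst l" "inv_letter l \<noteq> l" "l \<noteq> inv_letter l"
  by (auto simp: inv_letter_def prod_eq_iff)

lemma inv_letter_iff: "(fst l = fst l' \<longrightarrow> snd l = snd l') \<longleftrightarrow> l' \<noteq> inv_letter l"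
  by (auto simp: inv_letter_def prod_eq_iff)

text \<open>Words are applied from their right end, so the shared initial part of two geodesics from
  one base point is recorded as a common suffix. It is found as a common prefix of the reversed
  words.\<close>

lemma common_suffix:
  obtains a b c where "xs = a @ c" "ys = b @ c" "a = [] \<or> b = [] \<or> last a \<noteq> last b"
proof -
  have "\<exists>c a b. us = c @ a \<and> vs = c @ b \<and> (a = [] \<or> b = [] \<or> hd a \<noteq> hd b)" for us vs :: "'a list"
  proof (induction us vs rule: longest_common_prefix.induct)
    case (1 x xs y ys)
    show ?case
    proof (cases "x = y")
      case True
      then obtain c a b where "xs = c @ a \<and> ys = c @ b \<and> (a = [] \<or> b = [] \<or> hd a \<noteq> hd b)"
        using 1 by blast
      then show ?thesis using True by (intro exI[of _ "x # c"] exI[of _ a] exI[of _ b]) auto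
    next
      case False
      then show ?thesis by (intro exI[of _ "[]"] exI[of _ "x # xs"] exI[of _ "y # ys"]) auto
    qed
  qed auto
  from this[of "rev xs" "rev ys"] obtain c a b
    where *: "rev xs = c @ a" "rev ys = c @ b" "a = [] \<or> b = [] \<or> hd a \<noteq> hd b" by blast
  have "xs = rev a @ rev c" "ys = rev b @ rev c" using *(1,2) by (metis rev_append rev_rev_ident)+
  moreover have "rev a = [] \<or> rev b = [] \<or> last (rev a) \<noteq> last (rev b)" using *(3) by (auto simp: last_rev)
  ultimately show thesis using that by blast
qed

lemma reduced_word_Nil [simp]: "reduced_word []"
  by (simp add: reduced_word_def)

lemma reduced_word_Cons:
  "reduced_word (l # w) \<longleftrightarrow> reduced_word w \<and> (w = [] \<or> hd w \<noteq> inv_letter l)"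
  by (auto simp: reduced_word_def successively_Cons inv_letter_iff)

lemma reduced_word_append:
  "reduced_word (u @ w) \<longleftrightarrow>
     reduced_word u \<and> reduced_word w \<and> (u = [] \<or> w = [] \<or> hd w \<noteq> inv_letter (last u))"
  by (auto simp: reduced_word_def successively_append_iff inv_letter_iff)

lemma reduced_word_replicate: "reduced_word (replicate k l)"
  by (induction k) (auto simp: reduced_word_Cons)

lemma reduced_word_inverse: "reduced_word w \<Longrightarrow> reduced_word (map inv_letter (rev w))"
proof (induction w)
  case (Cons l w)
  then show ?case
    by (auto simp: reduced_word_Cons reduced_word_append last_map last_rev)
qed simp

locale free_basis =
  fixes F :: "('f, 'b) monoid_scheme" (structure) and I :: "'i set" and f :: "'i \<Rightarrow> 'f"
  assumes freely: "freely_generated F I f"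
begin

sublocale group F
  using freely by (simp add: freely_generated_def)

definition valid :: "('i \<times> bool) list \<Rightarrow> bool" where
  "valid w \<longleftrightarrow> fst ` set w \<subseteq> I \<and> reduced_word w"

definition act :: "'i \<times> bool \<Rightarrow> 'f" where "act l = letter F f l"

definition val :: "('i \<times> bool) list \<Rightarrow> 'f" where "val w = word_value F f w"

definition nf :: "'f \<Rightarrow> ('i \<times> bool) list" where
  "nf g = (THE w. valid w \<and> val w = g)"

definition len :: "'f \<Rightarrow> nat" where "len g = length (nf g)"

lemma f_closed [simp]: "i \<in> I \<Longrightarrow> f i \<in> carrier F"
  using freely by (auto simp: freely_generated_def)

lemma act_closed [simp]: "fst l \<in> I \<Longrightarrow> act l \<in> carrier F"
  by (simp add: act_def letter_def)

lemma act_inv_letter: "fst l \<in> I \<Longrightarrow> act (inv_letter l) = inv (act l)"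
  by (simp add: act_def letter_def inv_letter_def)

lemma val_Nil [simp]: "val [] = \<one>"
  by (simp add: val_def word_value_def)

lemma val_Cons [simp]: "val (l # w) = act l \<otimes> val w"
  by (simp add: val_def word_value_def act_def)

lemma val_closed [simp]: "fst ` set w \<subseteq> I \<Longrightarrow> val w \<in> carrier F"
  by (induction w) auto

lemma val_append: "fst ` set u \<subseteq> I \<Longrightarrow> fst ` set w \<subseteq> I \<Longrightarrow> val (u @ w) = val u \<otimes> val w"
  by (induction u) (auto simp: m_assoc)

lemma val_inverse: "fst ` set w \<subseteq> I \<Longrightarrow> val (map inv_letter (rev w)) = inv (val w)"
  by (induction w) (auto simp: val_append act_inv_letter inv_mult_group image_image)

lemma valid_inverse: "valid w \<Longrightarrow> valid (map inv_letter (rev w))"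
  by (auto simp: valid_def reduced_word_inverse image_image)

lemma valid_Nil [simp]: "valid []"
  by (simp add: valid_def)

lemma valid_closed: "valid w \<Longrightarrow> fst ` set w \<subseteq> I"
  by (simp add: valid_def)

lemma valid_val_closed [simp]: "valid w \<Longrightarrow> val w \<in> carrier F"
  by (simp add: valid_def)

lemma ex1_nf: "g \<in> carrier F \<Longrightarrow> \<exists>!w. valid w \<and> val w = g"
  using freely by (simp add: freely_generated_def valid_def val_def conj_assoc)

lemma nf: assumes "g \<in> carrier F" shows "valid (nf g)" "val (nf g) = g"
  using theI'[OF ex1_nf[OF assms]] by (auto simp: nf_def)

lemma nf_val: "valid w \<Longrightarrow> nf (val w) = w"
  using ex1_nf[of "val w"] nf[of "val w"] by (auto simp: valid_val_closed)

lemma len_val: "valid w \<Longrightarrow> len (val w) = length w"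
  by (simp add: len_def nf_val)

lemma len_one [simp]: "len \<one> = 0"
  using len_val[of "[]"] by simp

lemma len_0: "g \<in> carrier F \<Longrightarrow> len g = 0 \<longleftrightarrow> g = \<one>"
  using nf(2)[of g] len_one by (auto simp: len_def)

lemma nf_inv: "g \<in> carrier F \<Longrightarrow> nf (inv g) = map inv_letter (rev (nf g))"
  by (metis nf nf_val val_inverse valid_inverse valid_closed)

lemma len_inv [simp]: "g \<in> carrier F \<Longrightarrow> len (inv g) = len g"
  by (simp add: len_def nf_inv)

lemma valid_Cons: "valid (l # w) \<longleftrightarrow> fst l \<in> I \<and> valid w \<and> (w = [] \<or> hd w \<noteq> inv_letter l)"
  by (auto simp: valid_def reduced_word_Cons)

lemma valid_append:
  "valid (u @ w) \<longleftrightarrow> valid u \<and> valid w \<and> (u = [] \<or> w = [] \<or> hd w \<noteq> inv_letter (last u))"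
  by (auto simp: valid_def reduced_word_append)

lemma valid_replicate: "fst l \<in> I \<Longrightarrow> valid (replicate k l)"
  by (auto simp: valid_def reduced_word_replicate)

lemma val_replicate: "fst l \<in> I \<Longrightarrow> val (replicate k l) = act l [^] k"
proof (induction k)
  case (Suc k)
  then show ?case using nat_pow_Suc2[of "act l" k] by simp
qed simp

section \<open>The right-invariant tree metric, geodesics and medians\<close>

definition gd :: "'f \<Rightarrow> 'f \<Rightarrow> nat" where "gd u v = len (v \<otimes> inv u)"

text \<open>The metric interval; in a tree this is the vertex set of the unique geodesic.\<close>

definition seg :: "'f \<Rightarrow> 'f \<Rightarrow> 'f set" where
  "seg u v = {z \<in> carrier F. gd u z + gd z v = gd u v}"

lemma gd_self [simp]: "u \<in> carrier F \<Longrightarrow> gd u u = 0"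
  by (simp add: gd_def)

lemma gd_eq_0: "u \<in> carrier F \<Longrightarrow> v \<in> carrier F \<Longrightarrow> gd u v = 0 \<longleftrightarrow> u = v"
  by (simp add: gd_def len_0) (metis inv_closed inv_equality inv_inv r_inv)

lemma gd_commute: "u \<in> carrier F \<Longrightarrow> v \<in> carrier F \<Longrightarrow> gd u v = gd v u"
  using len_inv[of "v \<otimes> inv u"] by (simp add: gd_def inv_mult_group)

lemma quotient_translate:
  "u \<in> carrier F \<Longrightarrow> v \<in> carrier F \<Longrightarrow> g \<in> carrier F \<Longrightarrow> (v \<otimes> g) \<otimes> inv (u \<otimes> g) = v \<otimes> inv u"
proof -
  assume c: "u \<in> carrier F" "v \<in> carrier F" "g \<in> carrier F"
  have "(v \<otimes> g) \<otimes> inv (u \<otimes> g) = v \<otimes> (g \<otimes> inv g) \<otimes> inv u"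
    using c by (simp only: inv_mult_group m_assoc m_closed inv_closed)
  then show ?thesis using c by simp
qed

lemma gd_translate:
  "u \<in> carrier F \<Longrightarrow> v \<in> carrier F \<Longrightarrow> g \<in> carrier F \<Longrightarrow> gd (u \<otimes> g) (v \<otimes> g) = gd u v"
  by (simp add: gd_def quotient_translate)

lemma quotient_quotient:
  "u \<in> carrier F \<Longrightarrow> v \<in> carrier F \<Longrightarrow> w \<in> carrier F \<Longrightarrow>
    (v \<otimes> inv w) \<otimes> inv (u \<otimes> inv w) = v \<otimes> inv u"
  by (rule quotient_translate) auto

text \<open>The words of two elements, seen from a common base point, branch after their longest common suffix.\<close>

lemma tripod:
  assumes "x \<in> carrier F" "y \<in> carrier F" "z \<in> carrier F"
  obtains a b c where "nf (y \<otimes> inv x) = a @ c" "nf (z \<otimes> inv x) = b @ c"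
    "nf (z \<otimes> inv y) = b @ map inv_letter (rev a)" "a = [] \<or> b = [] \<or> last a \<noteq> last b"
proof -
  let ?y = "y \<otimes> inv x" and ?z = "z \<otimes> inv x"
  obtain a b c where abc: "nf ?y = a @ c" "nf ?z = b @ c" "a = [] \<or> b = [] \<or> last a \<noteq> last b"
    using common_suffix .
  have v: "valid (a @ c)" "valid (b @ c)" "val (a @ c) = ?y" "val (b @ c) = ?z"
    using nf[of ?y] nf[of ?z] assms abc by auto
  then have vv: "valid a" "valid b" "valid c" by (auto simp: valid_append)
  have "valid (b @ map inv_letter (rev a))"
    using vv abc(3) valid_inverse[OF vv(1)]
    by (auto simp: valid_append hd_map hd_rev) (metis inv_letter_simps(1))
  moreover have "val (b @ map inv_letter (rev a)) = ?z \<otimes> inv ?y"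
  proof -
    have "val (b @ map inv_letter (rev a)) = val b \<otimes> inv (val a)"
      using vv[THEN valid_closed] by (subst val_append) (auto simp: val_inverse image_image)
    also have "\<dots> = (val b \<otimes> val c) \<otimes> inv (val a \<otimes> val c)"
      using vv by (simp add: quotient_translate)
    finally show ?thesis
      using v vv by (simp add: val_append valid_closed)
  qed
  moreover have "?z \<otimes> inv ?y = z \<otimes> inv y" using assms by (simp add: quotient_quotient)
  ultimately show thesis using that abc nf_val by metis
qed

lemma gd_triangle:
  assumes "x \<in> carrier F" "y \<in> carrier F" "z \<in> carrier F"
  shows "gd y z \<le> gd y x + gd x z"
proof -
  obtain a b c where *: "nf (y \<otimes> inv x) = a @ c" "nf (z \<otimes> inv x) = b @ c"
    "nf (z \<otimes> inv y) = b @ map inv_letter (rev a)" using tripod[OF assms] .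
  have "gd y x = gd x y" using assms by (simp add: gd_commute)
  then show ?thesis using * by (simp add: gd_def len_def)
qed

text \<open>In the notation of \<open>tripod\<close>, the two distances add up to
  \<open>gd x y\<close> exactly when the branch \<open>b\<close> towards \<open>z\<close> is empty,
  that is, when the geodesic to \<open>z\<close> is an initial part of the geodesic to
  \<open>y\<close>.\<close>

lemma seg_iff_suffix:
  assumes "x \<in> carrier F" "y \<in> carrier F" "z \<in> carrier F"
  shows "z \<in> seg x y \<longleftrightarrow> suffix (nf (z \<otimes> inv x)) (nf (y \<otimes> inv x))"
proof -
  obtain a b c where *: "nf (y \<otimes> inv x) = a @ c" "nf (z \<otimes> inv x) = b @ c"
    "nf (z \<otimes> inv y) = b @ map inv_letter (rev a)" "a = [] \<or> b = [] \<or> last a \<noteq> last b"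
    using tripod[OF assms] .
  have "gd z y = gd y z" using assms by (simp add: gd_commute)
  then have "z \<in> seg x y \<longleftrightarrow> length b + length c + (length a + length b) = length a + length c"
    using * assms by (simp add: seg_def gd_def len_def)
  also have "\<dots> \<longleftrightarrow> b = []" by auto
  also have "\<dots> \<longleftrightarrow> suffix (b @ c) (a @ c)" using *(4) by (cases "b = []") (auto simp: suffix_def)
  finally show ?thesis using * by simp
qed

lemma seg_subset: "seg x y \<subseteq> carrier F"
  by (auto simp: seg_def)

lemma seg_commute: "x \<in> carrier F \<Longrightarrow> y \<in> carrier F \<Longrightarrow> seg x y = seg y x"
  by (auto simp: seg_def gd_commute)

lemma seg_ends [simp]: "x \<in> carrier F \<Longrightarrow> y \<in> carrier F \<Longrightarrow> x \<in> seg x y"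
  "x \<in> carrier F \<Longrightarrow> y \<in> carrier F \<Longrightarrow> y \<in> seg x y"
  by (auto simp: seg_def)

text \<open>The three geodesics share the branch point of the tripod, reached from \<open>x\<close>
  by the common suffix \<open>c\<close>.\<close>

lemma median:
  assumes "x \<in> carrier F" "y \<in> carrier F" "z \<in> carrier F"
  obtains m where "m \<in> seg x y" "m \<in> seg y z" "m \<in> seg x z"
proof -
  obtain a b c where *: "nf (y \<otimes> inv x) = a @ c" "nf (z \<otimes> inv x) = b @ c"
    "nf (z \<otimes> inv y) = b @ map inv_letter (rev a)" using tripod[OF assms] .
  have "valid (a @ c)" using nf(1)[of "y \<otimes> inv x"] * assms by simp
  then have c: "valid c" "val c \<in> carrier F" by (auto simp: valid_append)
  let ?m = "val c \<otimes> x"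
  have m: "?m \<in> carrier F" "?m \<otimes> inv x = val c" using c assms by (auto simp: m_assoc)
  have nm: "nf (?m \<otimes> inv x) = c" using m c by (simp add: nf_val)
  have xy: "?m \<in> seg x y" using m assms * nm by (simp add: seg_iff_suffix suffix_def)
  have xz: "?m \<in> seg x z" using m assms * nm by (simp add: seg_iff_suffix suffix_def)
  have "gd x ?m = length c" "gd x y = length a + length c" "gd x z = length b + length c"
    "gd y z = length a + length b"
    using * nm by (auto simp: gd_def len_def)
  then have "gd ?m y = length a" "gd ?m z = length b" "gd y z = length a + length b"
    using xy xz by (auto simp: seg_def)
  moreover have "gd y ?m = gd ?m y" using m assms by (simp add: gd_commute)
  ultimately have "?m \<in> seg y z" using m by (simp add: seg_def)
  then show thesis using that xy xz by blast
qed

lemma seg_trans: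
  assumes "x \<in> carrier F" "y \<in> carrier F" "m \<in> seg x y" "z \<in> seg x m"
  shows "z \<in> seg x y"
proof -
  have c: "m \<in> carrier F" "z \<in> carrier F" using assms seg_subset by blast+
  have "suffix (nf (z \<otimes> inv x)) (nf (m \<otimes> inv x))" "suffix (nf (m \<otimes> inv x)) (nf (y \<otimes> inv x))"
    using assms c by (simp_all add: seg_iff_suffix)
  then have "suffix (nf (z \<otimes> inv x)) (nf (y \<otimes> inv x))" by (rule suffix_order.trans)
  then show ?thesis using c assms by (simp add: seg_iff_suffix)
qed

lemma seg_linear:
  assumes "x \<in> carrier F" "y \<in> carrier F" "m \<in> seg x y" "z \<in> seg x y" "gd x z \<le> gd x m"
  shows "z \<in> seg x m"
proof -
  have c: "m \<in> carrier F" "z \<in> carrier F" using assms seg_subset by blast+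
  have "suffix (nf (z \<otimes> inv x)) (nf (y \<otimes> inv x))" "suffix (nf (m \<otimes> inv x)) (nf (y \<otimes> inv x))"
    using assms c by (simp_all add: seg_iff_suffix)
  moreover have "length (nf (z \<otimes> inv x)) \<le> length (nf (m \<otimes> inv x))"
    using assms(5) by (simp add: gd_def len_def)
  ultimately have "suffix (nf (z \<otimes> inv x)) (nf (m \<otimes> inv x))"
    by (rule suffix_length_suffix)
  then show ?thesis using c assms by (simp add: seg_iff_suffix)
qed

lemma seg_unique:
  assumes "x \<in> carrier F" "y \<in> carrier F" "m \<in> seg x y" "z \<in> seg x y" "gd x z = gd x m"
  shows "z = m"
proof -
  have c: "m \<in> carrier F" "z \<in> carrier F" using assms seg_subset by blast+
  have "z \<in> seg x m" using seg_linear assms by simp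
  then have "gd z m = 0" using assms(5) by (simp add: seg_def)
  then show ?thesis using c by (simp add: gd_eq_0)
qed

text \<open>Triangles in a tree are tripods: a point of \<open>seg x y\<close> lies on the
  \<open>x\<close> side or on the \<open>y\<close> side of the median, and both halves continue
  towards \<open>w\<close>.\<close>

lemma seg_Un:
  assumes "x \<in> carrier F" "y \<in> carrier F" "w \<in> carrier F"
  shows "seg x y \<subseteq> seg x w \<union> seg w y"
proof
  fix z assume z: "z \<in> seg x y"
  obtain m where m: "m \<in> seg x y" "m \<in> seg y w" "m \<in> seg x w"
    using median[OF assms] .
  have c: "m \<in> carrier F" "z \<in> carrier F" using z m seg_subset by blast+
  show "z \<in> seg x w \<union> seg w y"
  proof (cases "gd x z \<le> gd x m")
    case True
    then have "z \<in> seg x m" using seg_linear z m assms by blast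
    then show ?thesis using seg_trans assms m by blast
  next
    case False
    moreover have "gd x z + gd z y = gd x m + gd m y" using z m(1) by (simp add: seg_def)
    ultimately have "gd y z \<le> gd y m" using c assms by (simp add: gd_commute)
    moreover have "z \<in> seg y x" "m \<in> seg y x" using z m assms seg_commute by auto
    ultimately have "z \<in> seg y m" using seg_linear assms by blast
    then have "z \<in> seg y w" using seg_trans assms m by blast
    then show ?thesis using seg_commute assms by blast
  qed
qed

lemma seg_translate:
  assumes "u \<in> carrier F" "v \<in> carrier F" "z \<in> carrier F" "g \<in> carrier F"
  shows "z \<otimes> g \<in> seg (u \<otimes> g) (v \<otimes> g) \<longleftrightarrow> z \<in> seg u v"
  using assms by (simp add: seg_def gd_translate)

definition cnvx :: "'f set \<Rightarrow> bool" where
  "cnvx K \<longleftrightarrow> K \<subseteq> carrier F \<and> (\<forall>u\<in>K. \<forall>v\<in>K. seg u v \<subseteq> K)"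

text \<open>By \<open>seg_Un\<close> the geodesic between two points runs inside their geodesics to
  the centre, so in a tree star-shaped sets are convex.\<close>

lemma cnvx_star:
  assumes "K \<subseteq> carrier F" "v \<in> K" "\<And>z. z \<in> K \<Longrightarrow> seg v z \<subseteq> K"
  shows "cnvx K"
  unfolding cnvx_def
proof (intro conjI ballI)
  fix a b assume ab: "a \<in> K" "b \<in> K"
  have "seg a b \<subseteq> seg a v \<union> seg v b" using ab assms by (intro seg_Un) auto
  also have "seg a v = seg v a" using ab assms by (intro seg_commute) auto
  finally show "seg a b \<subseteq> K" using assms ab by blast
qed (use assms in auto)

text \<open>\<open>p\<close> is the projection of \<open>a\<close> to the subtree \<open>K\<close>:
  the median of \<open>z\<close>, \<open>p\<close>, \<open>a\<close> lies both in \<open>K\<close>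
  and on \<open>seg p a\<close>, hence equals \<open>p\<close>.\<close>

lemma gate:
  assumes "cnvx K" "z \<in> K" "p \<in> K" "a \<in> carrier F" "\<And>y. y \<in> seg p a \<Longrightarrow> y \<in> K \<Longrightarrow> y = p"
  shows "p \<in> seg z a"
proof -
  have c: "z \<in> carrier F" "p \<in> carrier F" using assms by (auto simp: cnvx_def)
  obtain m where m: "m \<in> seg z p" "m \<in> seg p a" "m \<in> seg z a"
    using median[OF c assms(4)] .
  have "m \<in> K" using m assms(1-3) unfolding cnvx_def by blast
  then show ?thesis using assms(5) m by blast
qed

text \<open>The connected component of \<open>u\<close> in the subgraph induced by \<open>C\<close>;
  in a tree, points are joined inside \<open>C\<close> exactly when their geodesic stays in
  \<open>C\<close>.\<close>

definition comp :: "'f set \<Rightarrow> 'f \<Rightarrow> 'f set" where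
  "comp C u = {v \<in> C. seg u v \<subseteq> C}"

lemma comp_subset: "comp C u \<subseteq> C"
  by (auto simp: comp_def)

lemma seg_self [simp]: "u \<in> carrier F \<Longrightarrow> seg u u = {u}"
  by (auto simp: seg_def gd_commute gd_eq_0)

lemma comp_self: "C \<subseteq> carrier F \<Longrightarrow> u \<in> C \<Longrightarrow> u \<in> comp C u"
  by (auto simp: comp_def)

lemma cnvx_comp:
  assumes "C \<subseteq> carrier F" "u \<in> C"
  shows "cnvx (comp C u)"
proof (rule cnvx_star)
  show "comp C u \<subseteq> carrier F" using assms by (auto simp: comp_def)
  show "u \<in> comp C u" using comp_self assms .
  fix z assume z: "z \<in> comp C u"
  show "seg u z \<subseteq> comp C u"
  proof
    fix y assume y: "y \<in> seg u z"
    have "seg u y \<subseteq> seg u z" using seg_trans[of u z y] assms z y by (auto simp: comp_def)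
    then show "y \<in> comp C u" using z y by (auto simp: comp_def)
  qed
qed

lemma comp_step:
  assumes "C \<subseteq> carrier F" "u \<in> C" "v \<in> comp C u" "z \<in> C" "seg v z \<subseteq> C"
  shows "z \<in> comp C u"
proof -
  have "seg u z \<subseteq> seg u v \<union> seg v z" using assms by (intro seg_Un) (auto simp: comp_def)
  then show ?thesis using assms by (auto simp: comp_def)
qed

end

section \<open>Rays, tiles and exact coverings of paths\<close>

context free_basis
begin

text \<open>Paths are cut out of infinite reduced letter sequences, so that a path can be prolonged
  beyond its target.\<close>

definition ray :: "(nat \<Rightarrow> 'i \<times> bool) \<Rightarrow> bool" where
  "ray a \<longleftrightarrow> (\<forall>k. fst (a k) \<in> I \<and> a (Suc k) \<noteq> inv_letter (a k))"

primrec walk :: "'f \<Rightarrow> (nat \<Rightarrow> 'i \<times> bool) \<Rightarrow> nat \<Rightarrow> 'f" where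
  "walk v a 0 = v"
| "walk v a (Suc k) = act (a k) \<otimes> walk v a k"

lemma walk_closed [simp]: "ray a \<Longrightarrow> v \<in> carrier F \<Longrightarrow> walk v a k \<in> carrier F"
  by (induction k) (auto simp: ray_def)

lemma valid_ray_word: "ray a \<Longrightarrow> valid (rev (map a [i..<j]))"
proof (induction j)
  case (Suc j)
  show ?case
  proof (cases "i < j")
    case True
    then obtain j' where j': "j = Suc j'" "i \<le> j'" by (cases j) auto
    have "a j' \<noteq> inv_letter (a j)" using Suc.prems j'(1) unfolding ray_def by (metis inv_letter_simps(1))
    then show ?thesis using Suc j' by (auto simp: valid_Cons ray_def)
  next
    case False
    then show ?thesis using Suc by (auto simp: valid_Cons ray_def)
  qed
qed simp

lemma walk_val:
  assumes "ray a" "v \<in> carrier F" "i \<le> j"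
  shows "walk v a j = val (rev (map a [i..<j])) \<otimes> walk v a i"
  using assms(3)
proof (induction j rule: dec_induct)
  case base
  then show ?case using assms by simp
next
  case (step j)
  have "val (rev (map a [i..<j])) \<in> carrier F" using valid_ray_word[OF assms(1)] by simp
  then show ?case using step assms by (simp add: m_assoc ray_def)
qed

lemma gd_walk:
  assumes "ray a" "v \<in> carrier F" "i \<le> j"
  shows "gd (walk v a i) (walk v a j) = j - i"
proof -
  have v: "valid (rev (map a [i..<j]))" using valid_ray_word[OF assms(1)] .
  then have "walk v a j \<otimes> inv (walk v a i) = val (rev (map a [i..<j]))"
    using assms by (simp add: walk_val[of a v i j] m_assoc)
  then show ?thesis using v by (simp add: gd_def len_val)
qed

lemma walk_in_seg:
  assumes "ray a" "v \<in> carrier F" "i \<le> k" "k \<le> j"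
  shows "walk v a k \<in> seg (walk v a i) (walk v a j)"
  using assms by (simp add: seg_def gd_walk)

lemma seg_walk:
  assumes "ray a" "v \<in> carrier F" "i \<le> j" "z \<in> seg (walk v a i) (walk v a j)"
  obtains k where "i \<le> k" "k \<le> j" "z = walk v a k"
proof -
  let ?k = "i + gd (walk v a i) z"
  have k: "?k \<le> j" using assms gd_walk[OF assms(1-3)] by (auto simp: seg_def)
  have "walk v a ?k \<in> seg (walk v a i) (walk v a j)" using walk_in_seg assms k by simp
  moreover have "gd (walk v a i) z = gd (walk v a i) (walk v a ?k)" using gd_walk assms by simp
  ultimately have "z = walk v a ?k" using seg_unique assms walk_closed by metis
  then show thesis using that k by (meson le_add1)
qed

lemma ray_exists:
  assumes "v \<in> carrier F" "u \<in> carrier F" "u \<noteq> v"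
  obtains a where "ray a" "walk v a (gd v u) = u"
proof -
  let ?w = "nf (u \<otimes> inv v)"
  define n where "n = length ?w"
  \<comment> \<open>The letters leading from \<open>v\<close> to \<open>u\<close> in their order of
    application, followed by repetitions of the last one, which never cancel.\<close>
  define a where "a k = rev ?w ! min k (n - 1)" for k
  have w: "valid ?w" "val ?w = u \<otimes> inv v" using nf assms by auto
  have n: "n = gd v u" by (simp add: n_def gd_def len_def)
  then have "n \<noteq> 0" using gd_eq_0 assms by auto
  have "ray a" unfolding ray_def
  proof (intro allI conjI)
    fix k
    have "a k \<in> set (rev ?w)" using \<open>n \<noteq> 0\<close> unfolding a_def
      by (intro nth_mem) (simp add: n_def min_less_iff_disj)
    then show "fst (a k) \<in> I" using w by (auto simp: valid_def)
    show "a (Suc k) \<noteq> inv_letter (a k)"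
    proof (cases "Suc k < n")
      case True
      then have ak: "a k = rev ?w ! k" by (simp add: a_def min_absorb1)
      have "rev ?w = take (Suc k) (rev ?w) @ drop (Suc k) (rev ?w)" by simp
      then have split: "?w = rev (drop (Suc k) (rev ?w)) @ rev (take (Suc k) (rev ?w))"
        by (metis rev_append rev_rev_ident)
      have ne: "take (Suc k) (rev ?w) \<noteq> []" "drop (Suc k) (rev ?w) \<noteq> []" using True by (auto simp: n_def)
      have "hd (rev (take (Suc k) (rev ?w))) \<noteq> inv_letter (last (rev (drop (Suc k) (rev ?w))))"
        using w(1) ne by (subst (asm) split) (auto simp: valid_append)
      moreover have "hd (rev (take (Suc k) (rev ?w))) = a k"
        using True ne ak by (simp add: hd_rev last_conv_nth n_def)
      moreover have "last (rev (drop (Suc k) (rev ?w))) = a (Suc k)"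
        using True ne by (simp add: last_rev hd_drop_conv_nth a_def n_def)
      ultimately show ?thesis by (metis inv_letter_simps(1))
    next
      case False
      then have "a (Suc k) = a k" by (auto simp: a_def min_def intro: arg_cong)
      then show ?thesis by simp
    qed
  qed
  moreover have "map a [0..<n] = rev ?w"
    by (rule nth_equalityI) (auto simp: a_def n_def)
  then have "walk v a n = u" using walk_val[OF \<open>ray a\<close> assms(1), of 0 n] w assms by (simp add: m_assoc)
  ultimately show thesis using that n by simp
qed

definition lp :: "'i \<times> bool \<Rightarrow> nat \<Rightarrow> 'f \<Rightarrow> 'f" where "lp l k s = act l [^] k \<otimes> s"

lemma lp_closed [simp]: "fst l \<in> I \<Longrightarrow> s \<in> carrier F \<Longrightarrow> lp l k s \<in> carrier F"
  by (simp add: lp_def)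

lemma lp_0 [simp]: "s \<in> carrier F \<Longrightarrow> lp l 0 s = s"
  by (simp add: lp_def)

lemma lp_lp: "fst l \<in> I \<Longrightarrow> s \<in> carrier F \<Longrightarrow> lp l i (lp l j s) = lp l (i + j) s"
  by (simp add: lp_def m_assoc[symmetric] nat_pow_mult)

lemma lp_1: "fst l \<in> I \<Longrightarrow> lp l (Suc 0) s = act l \<otimes> s"
  by (simp add: lp_def)

lemma lp_inv_cancel: "fst l \<in> I \<Longrightarrow> s \<in> carrier F \<Longrightarrow> lp (inv_letter l) k (lp l k s) = s"
  by (simp add: lp_def act_inv_letter nat_pow_inv m_assoc[symmetric])

lemma lp_inv_less:
  assumes "fst l \<in> I" "s \<in> carrier F" "j \<le> k"
  shows "lp (inv_letter l) j (lp l k s) = lp l (k - j) s"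
proof -
  have "lp l k s = lp l j (lp l (k - j) s)" using assms by (simp add: lp_lp)
  then show ?thesis using assms by (simp add: lp_inv_cancel)
qed

lemma lp_inv_greater:
  assumes "fst l \<in> I" "s \<in> carrier F" "k \<le> j"
  shows "lp (inv_letter l) j (lp l k s) = lp (inv_letter l) (j - k) s"
proof -
  have "lp (inv_letter l) j (lp l k s) = lp (inv_letter l) (j - k) (lp (inv_letter l) k (lp l k s))"
    using assms lp_lp[of "inv_letter l" "lp l k s" "j - k" k] by simp
  then show ?thesis using assms by (simp add: lp_inv_cancel)
qed

lemma gd_lp: "fst l \<in> I \<Longrightarrow> s \<in> carrier F \<Longrightarrow> gd s (lp l k s) = k"
  using len_val[of "replicate k l"]
  by (simp add: gd_def lp_def m_assoc valid_replicate val_replicate)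

lemma walk_straight:
  assumes "ray a" "v \<in> carrier F" "\<And>k. i \<le> k \<Longrightarrow> k < i + n \<Longrightarrow> a k = l"
  shows "walk v a (i + n) = lp l n (walk v a i)"
  using assms(3)
proof (induction n)
  case 0
  then show ?case using assms by simp
next
  case (Suc n)
  have l: "fst l \<in> I" using assms(1) Suc.prems[of i] unfolding ray_def by force
  have "walk v a (i + Suc n) = act l \<otimes> lp l n (walk v a i)" using Suc by simp
  also have "\<dots> = lp l (Suc 0) (lp l n (walk v a i))" using l by (simp add: lp_1)
  finally show ?case using l assms by (simp add: lp_lp)
qed

lemma walk_straight_back:
  assumes "ray a" "v \<in> carrier F" "n \<le> j" "n > 0" "\<And>k. j - n \<le> k \<Longrightarrow> k < j \<Longrightarrow> a k = l"
  shows "walk v a (j - n) = lp (inv_letter l) n (walk v a j)"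
proof -
  have l: "fst l \<in> I" using assms(1,3,4) assms(5)[of "j - 1"] unfolding ray_def by (metis diff_less diff_le_mono2 Suc_leI One_nat_def less_le_trans zero_less_one)
  have "walk v a j = lp l n (walk v a (j - n))"
    using walk_straight[of a v "j - n" n l] assms by simp
  then show ?thesis using l assms by (simp add: lp_inv_cancel)
qed

end

section \<open>Finite subtrees, their lines and their tiles\<close>

locale shape = free_basis F I f
  for F :: "('f, 'b) monoid_scheme" (structure) and I :: "'i set" and f :: "'i \<Rightarrow> 'f" +
  fixes S :: "'f set"
  assumes finite_I: "finite I" and finite_S: "finite S" and S_nonempty: "S \<noteq> {}"
    and cnvx_S: "cnvx S"
begin

lemma S_closed [simp]: "s \<in> S \<Longrightarrow> s \<in> carrier F"
  using cnvx_S by (auto simp: cnvx_def)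

text \<open>The lengths \<open>len s\<close> are included because the base \<open>w\<close> of
  \<open>tile w\<close> need not lie in the tile; \<open>diam\<close> must also bound the distance
  from the base to the points of the tile.\<close>

definition diam :: nat where
  "diam = Max ((\<lambda>(s, t). gd s t) ` (S \<times> S) \<union> len ` S)"

lemma gd_le_diam: "s \<in> S \<Longrightarrow> t \<in> S \<Longrightarrow> gd s t \<le> diam"
  unfolding diam_def using finite_S by (intro Max_ge) auto

lemma len_le_diam: "s \<in> S \<Longrightarrow> len s \<le> diam"
  unfolding diam_def using finite_S by (intro Max_ge) auto

definition fwd :: "'i \<times> bool \<Rightarrow> 'f \<Rightarrow> nat" where
  "fwd l s = (LEAST k. lp l (Suc k) s \<notin> S)"

lemma fwd_out:
  assumes "fst l \<in> I" "s \<in> S"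
  shows "lp l (Suc (fwd l s)) s \<notin> S"
proof -
  have "lp l (Suc diam) s \<notin> S" using gd_lp[of l s "Suc diam"] gd_le_diam[of s] assms by force
  then show ?thesis unfolding fwd_def by (rule LeastI)
qed

lemma fwd_in:
  assumes "fst l \<in> I" "s \<in> S" "j \<le> fwd l s"
  shows "lp l j s \<in> S"
proof (cases j)
  case (Suc i)
  then show ?thesis using assms not_less_Least[of i "\<lambda>k. lp l (Suc k) s \<notin> S"] by (auto simp: fwd_def)
qed (use assms in simp)

lemma fwd_eqI:
  assumes "fst l \<in> I" "s \<in> S" "\<And>j. j \<le> k \<Longrightarrow> lp l j s \<in> S" "lp l (Suc k) s \<notin> S"
  shows "fwd l s = k"
  using fwd_out[OF assms(1,2)] fwd_in[OF assms(1,2), of "Suc k"] assms(3)[of "Suc (fwd l s)"] assms(4)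
  by (meson Suc_leI not_less_eq_eq order_antisym not_le)

lemma fwd_move:
  assumes "fst l \<in> I" "s \<in> S" "j \<le> fwd l s"
  shows "fwd l (lp l j s) = fwd l s - j"
  using assms fwd_in[OF assms(1,2)] fwd_out[OF assms(1,2)]
  by (intro fwd_eqI) (auto simp: lp_lp)

lemma bwd_move:
  assumes "fst l \<in> I" "s \<in> S" "j \<le> fwd l s"
  shows "fwd (inv_letter l) (lp l j s) = fwd (inv_letter l) s + j"
proof (rule fwd_eqI)
  fix k assume k: "k \<le> fwd (inv_letter l) s + j"
  show "lp (inv_letter l) k (lp l j s) \<in> S"
  proof (cases "k \<le> j")
    case True
    then show ?thesis using assms by (simp add: lp_inv_less fwd_in)
  next
    case False
    then show ?thesis using assms k by (simp add: lp_inv_greater fwd_in)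
  qed
next
  show "lp (inv_letter l) (Suc (fwd (inv_letter l) s + j)) (lp l j s) \<notin> S"
    using assms fwd_out[of "inv_letter l" s] by (simp add: lp_inv_greater Suc_diff_le)
qed (use assms fwd_in in auto)

definition linelen :: "'i \<times> bool \<Rightarrow> 'f \<Rightarrow> nat" where
  "linelen l s = Suc (fwd l s + fwd (inv_letter l) s)"

lemma linelen_inv_letter: "linelen (inv_letter l) s = linelen l s"
  by (simp add: linelen_def)

lemma linelen_move:
  assumes "fst l \<in> I" "s \<in> S" "j \<le> fwd l s"
  shows "linelen l (lp l j s) = linelen l s"
  using assms by (simp add: linelen_def fwd_move bwd_move)

text \<open>A step along a line changes the number of steps left by one, so every value below the
  line length occurs on it. The required point may lie behind \<open>s\<close>, hence the direction
  \<open>l'\<close>. This is the freedom available for placing a tile.\<close>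

lemma line_point:
  assumes "fst l \<in> I" "s \<in> S" "n < linelen l s"
  obtains l' k where "fst l' = fst l" "lp l' k s \<in> S" "fwd l (lp l' k s) = n"
    "linelen l (lp l' k s) = linelen l s"
proof (cases "n \<le> fwd l s")
  case True
  then have "fwd l (lp l (fwd l s - n) s) = n" "lp l (fwd l s - n) s \<in> S"
    using assms by (auto simp: fwd_move fwd_in)
  then show thesis using that[of l "fwd l s - n"] linelen_move[OF assms(1,2)] by simp
next
  case False
  let ?l = "inv_letter l" and ?k = "n - fwd l s"
  have k: "?k \<le> fwd ?l s" using assms(3) False by (auto simp: linelen_def)
  then have "fwd l (lp ?l ?k s) = n"
    using bwd_move[of ?l s ?k] assms False by simp
  moreover have "lp ?l ?k s \<in> S" using k assms by (simp add: fwd_in)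
  moreover have "linelen l (lp ?l ?k s) = linelen l s"
    using linelen_move[of ?l s ?k] k assms by (simp add: linelen_inv_letter)
  ultimately show thesis using that[of ?l ?k] by simp
qed

text \<open>If no point were chosen by all its lines, one could pass from any point to the chosen point of
  one of its lines forever. Consecutive steps run in different directions, so in a free group such a
  walk never returns.\<close>

lemma choice_point:
  assumes "\<And>i s. i \<in> I \<Longrightarrow> s \<in> S \<Longrightarrow> \<exists>l k. fst l = i \<and> lp l k s \<in> S \<and> c i (lp l k s)"
  obtains s where "s \<in> S" "\<And>i. i \<in> I \<Longrightarrow> c i s"
proof (rule ccontr)
  assume neg: "\<not> thesis"
  obtain s0 where s0: "s0 \<in> S" using S_nonempty by blast
  have "\<exists>s w. s \<in> S \<and> valid w \<and> length w \<ge> n \<and> s = val w \<otimes> s0 \<and> (w = [] \<or> c (fst (hd w)) s)" for n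
  proof (induction n)
    case 0
    show ?case using s0 by (intro exI[of _ s0] exI[of _ "[]"]) auto
  next
    case (Suc n)
    then obtain s w where sw: "s \<in> S" "valid w" "length w \<ge> n" "s = val w \<otimes> s0"
      "w = [] \<or> c (fst (hd w)) s" by blast
    have "\<exists>i\<in>I. \<not> c i s" using neg that sw(1) by blast
    then obtain i where i: "i \<in> I" "\<not> c i s" by blast
    obtain l k where lk: "fst l = i" "lp l k s \<in> S" "c i (lp l k s)" using assms i sw by blast
    have "k \<noteq> 0" using lk i sw(1) by (metis lp_0 S_closed)
    let ?w = "replicate k l @ w"
    have "w = [] \<or> fst (hd w) \<noteq> i" using sw(5) i by auto
    then have "valid ?w" using lk i sw \<open>k \<noteq> 0\<close>
      by (auto simp: valid_append valid_replicate)
    moreover have "val ?w = act l [^] k \<otimes> val w"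
      using lk i valid_closed[OF sw(2)] by (subst val_append) (auto simp: val_replicate)
    then have "lp l k s = val ?w \<otimes> s0"
      using sw s0 lk i by (simp add: lp_def m_assoc)
    moreover have "hd ?w = l" using \<open>k \<noteq> 0\<close> by (cases k) auto
    ultimately show ?case using lk sw(3) \<open>k \<noteq> 0\<close>
      by (intro exI[of _ "lp l k s"] exI[of _ ?w]) auto
  qed
  from this[of "Suc diam"] obtain s w where sw: "s \<in> S" "valid w" "length w \<ge> Suc diam" "s = val w \<otimes> s0"
    by blast
  have "gd s0 s = length w" using sw s0 by (simp add: gd_def m_assoc len_val)
  then show False using gd_le_diam[OF s0 sw(1)] sw(3) by simp
qed

definition tile :: "'f \<Rightarrow> 'f set" where "tile w = (\<lambda>s. s \<otimes> w) ` S"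

text \<open>The solution \<open>w\<close> of \<open>s w = p\<close>: the tile based there has its
  copy of \<open>s\<close> at \<open>p\<close>.\<close>

definition base_at :: "'f \<Rightarrow> 'f \<Rightarrow> 'f" where "base_at s p = inv s \<otimes> p"

lemma tile_closed: "w \<in> carrier F \<Longrightarrow> tile w \<subseteq> carrier F"
  by (auto simp: tile_def)

lemma base_at_closed [simp]: "s \<in> S \<Longrightarrow> p \<in> carrier F \<Longrightarrow> base_at s p \<in> carrier F"
  by (simp add: base_at_def)

lemma mem_tile: "x \<in> carrier F \<Longrightarrow> w \<in> carrier F \<Longrightarrow> x \<in> tile w \<longleftrightarrow> x \<otimes> inv w \<in> S"
  by (auto simp: tile_def m_assoc intro!: image_eqI[of _ _ "x \<otimes> inv w"])

lemma tile_mult: "w \<in> carrier F \<Longrightarrow> g \<in> carrier F \<Longrightarrow> tile (w \<otimes> g) = (\<lambda>x. x \<otimes> g) ` tile w"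
  by (auto simp: tile_def m_assoc image_image)

lemma cnvx_tile:
  assumes "w \<in> carrier F" shows "cnvx (tile w)"
  unfolding cnvx_def
proof (intro conjI ballI subsetI)
  fix u v z assume uv: "u \<in> tile w" "v \<in> tile w" and z: "z \<in> seg u v"
  have c: "u \<in> carrier F" "v \<in> carrier F" "z \<in> carrier F"
    using uv z tile_closed assms seg_subset by blast+
  then have "z \<otimes> inv w \<in> seg (u \<otimes> inv w) (v \<otimes> inv w)" using z assms by (simp add: seg_translate)
  moreover have "u \<otimes> inv w \<in> S" "v \<otimes> inv w \<in> S" using uv mem_tile assms c by auto
  ultimately have "z \<otimes> inv w \<in> S" using cnvx_S by (auto simp: cnvx_def)
  then show "z \<in> tile w" using mem_tile assms c by auto
qed (use tile_closed assms in auto)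

lemma gd_tile:
  assumes "w \<in> carrier F" "u \<in> tile w" "v \<in> tile w" shows "gd u v \<le> diam"
  using assms gd_le_diam by (auto simp: tile_def gd_translate)

lemma gd_tile_base:
  assumes "w \<in> carrier F" "u \<in> tile w" shows "gd w u \<le> diam"
  using assms len_le_diam by (auto simp: tile_def gd_def m_assoc)

lemma mem_tile_at: "s \<in> S \<Longrightarrow> p \<in> carrier F \<Longrightarrow> p \<in> tile (base_at s p)"
  by (simp add: mem_tile base_at_def inv_mult_group m_assoc[symmetric])

text \<open>Right translation carries lines to lines, so the tile seen from \<open>p\<close> looks
  like \<open>S\<close> seen from \<open>s\<close>. Questions about tiles on straight paths become
  questions about \<open>fwd\<close>.\<close>

lemma lp_mem_tile_at:
  assumes "s \<in> S" "p \<in> carrier F" "fst l \<in> I"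
  shows "lp l k p \<in> tile (base_at s p) \<longleftrightarrow> lp l k s \<in> S"
proof -
  have "p \<otimes> (inv p \<otimes> s) = s" using assms by (simp add: m_assoc[symmetric])
  then have "lp l k p \<otimes> inv (base_at s p) = lp l k s"
    using assms by (simp add: lp_def base_at_def inv_mult_group m_assoc)
  then show ?thesis using assms by (simp add: mem_tile)
qed

text \<open>The numerical semigroup generated by the line lengths in one direction, with 0 as the
  empty sum: the lengths that tiles laid end to end can cover.\<close>

definition lengths :: "'i \<times> bool \<Rightarrow> nat set" where
  "lengths l = {sum_list ns | ns. set ns \<subseteq> linelen l ` S}"

text \<open>The indices \<open>i\<close> and \<open>j\<close> stand for points of what is to be
  joined, so only the \<open>j - i - 1\<close> points strictly between are to be covered, and no
  tile may touch the ends. Disjointness is demanded on the path only; \<open>fill_disjoint\<close>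
  extends it to whole tiles.\<close>

definition fill :: "(nat \<Rightarrow> 'f) \<Rightarrow> nat \<Rightarrow> nat \<Rightarrow> 'f set \<Rightarrow> bool" where
  "fill p i j W \<longleftrightarrow> finite W \<and> W \<subseteq> carrier F \<and>
     (\<forall>w\<in>W. p i \<notin> tile w \<and> p j \<notin> tile w \<and> (\<exists>k. i < k \<and> k < j \<and> p k \<in> tile w)) \<and>
     (\<forall>k. i < k \<and> k < j \<longrightarrow> (\<exists>w\<in>W. p k \<in> tile w)) \<and>
     (\<forall>w\<in>W. \<forall>w'\<in>W. \<forall>k. p k \<in> tile w \<and> p k \<in> tile w' \<longrightarrow> w = w')"

lemma fillD:
  assumes "fill p i j W"
  shows "finite W" "W \<subseteq> carrier F"
    and "w \<in> W \<Longrightarrow> p i \<notin> tile w" "w \<in> W \<Longrightarrow> p j \<notin> tile w"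
    and "w \<in> W \<Longrightarrow> \<exists>k. i < k \<and> k < j \<and> p k \<in> tile w"
    and "i < k \<Longrightarrow> k < j \<Longrightarrow> \<exists>w\<in>W. p k \<in> tile w"
    and "w \<in> W \<Longrightarrow> w' \<in> W \<Longrightarrow> p k \<in> tile w \<Longrightarrow> p k \<in> tile w' \<Longrightarrow> w = w'"
proof -
  note c = assms[unfolded fill_def]
  have *: "finite W" "W \<subseteq> carrier F"
    "\<forall>w\<in>W. p i \<notin> tile w \<and> p j \<notin> tile w \<and> (\<exists>k. i < k \<and> k < j \<and> p k \<in> tile w)"
    "\<forall>k. i < k \<and> k < j \<longrightarrow> (\<exists>w\<in>W. p k \<in> tile w)"
    "\<forall>w\<in>W. \<forall>w'\<in>W. \<forall>k. p k \<in> tile w \<and> p k \<in> tile w' \<longrightarrow> w = w'"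
    by (rule c[THEN conjunct1] c[THEN conjunct2, THEN conjunct1]
        c[THEN conjunct2, THEN conjunct2, THEN conjunct1]
        c[THEN conjunct2, THEN conjunct2, THEN conjunct2, THEN conjunct1]
        c[THEN conjunct2, THEN conjunct2, THEN conjunct2, THEN conjunct2])+
  show "finite W" "W \<subseteq> carrier F" using *(1,2) .
  show "p i \<notin> tile w" "p j \<notin> tile w" "\<exists>k. i < k \<and> k < j \<and> p k \<in> tile w" if "w \<in> W"
    using *(3)[rule_format, OF that] by simp_all
  show "\<exists>w\<in>W. p k \<in> tile w" if "i < k" "k < j" using *(4) that by simp
  show "w = w'" if "w \<in> W" "w' \<in> W" "p k \<in> tile w" "p k \<in> tile w'"
    using *(5)[rule_format, OF that(1,2), of k] that(3,4) by simp
qed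

end

section \<open>Exact covers of a stretch of a path\<close>

locale shape_ray = shape F I f S
  for F :: "('f, 'b) monoid_scheme" (structure) and I :: "'i set" and f :: "'i \<Rightarrow> 'f" and S :: "'f set" +
  fixes v :: 'f and a :: "nat \<Rightarrow> 'i \<times> bool"
  assumes ray: "ray a" and v: "v \<in> carrier F"
begin

abbreviation p :: "nat \<Rightarrow> 'f" where "p \<equiv> walk v a"

lemma p_closed [simp]: "p k \<in> carrier F"
  using ray v by simp

lemma a_closed [simp]: "fst (a k) \<in> I"
  using ray by (simp add: ray_def)

lemma cnvx_between:
  assumes "cnvx K" "p i \<in> K" "p j \<in> K" "i \<le> k" "k \<le> j" shows "p k \<in> K"
  using assms walk_in_seg[OF ray v, of i k j] by (auto simp: cnvx_def)

text \<open>A subtree meets a geodesic in an interval, so the two points just outside determine the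
  whole trace.\<close>

lemma cnvx_range:
  assumes "cnvx K" "p \<alpha> \<in> K" "p \<beta> \<in> K" "p (\<alpha> - 1) \<notin> K" "p (Suc \<beta>) \<notin> K" "0 < \<alpha>" "\<alpha> \<le> \<beta>"
  shows "p k \<in> K \<longleftrightarrow> \<alpha> \<le> k \<and> k \<le> \<beta>"
proof
  assume k: "p k \<in> K"
  have "k \<le> \<alpha> - 1 \<Longrightarrow> False" using cnvx_between[OF assms(1) k assms(2), of "\<alpha> - 1"] assms(4) by simp
  moreover have "Suc \<beta> \<le> k \<Longrightarrow> False" using cnvx_between[OF assms(1,3) k, of "Suc \<beta>"] assms(5) by (simp del: walk.simps)
  ultimately have "\<not> k \<le> \<alpha> - 1" "\<not> Suc \<beta> \<le> k" by blast+
  then show "\<alpha> \<le> k \<and> k \<le> \<beta>" by simp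
next
  assume "\<alpha> \<le> k \<and> k \<le> \<beta>"
  then show "p k \<in> K" using cnvx_between[OF assms(1,2,3)] by blast
qed

lemma fill_range:
  assumes "fill p i j W" "w \<in> W" "p k \<in> tile w"
  shows "i < k \<and> k < j"
proof -
  obtain m where m: "i < m" "m < j" "p m \<in> tile w" "p i \<notin> tile w" "p j \<notin> tile w"
    using assms(1,2) by (auto simp: fill_def)
  have c: "cnvx (tile w)" using assms cnvx_tile by (auto simp: fill_def)
  have "\<not> k \<le> i" using cnvx_between[OF c assms(3) m(3), of i] m by auto
  moreover have "\<not> j \<le> k" using cnvx_between[OF c m(3) assms(3), of j] m by auto
  ultimately show ?thesis by simp
qed

text \<open>The tile \<open>w\<close> takes the place of an end for both remaining stretches: by
  \<open>fill_range\<close> the traces of \<open>W1\<close>, \<open>w\<close> and \<open>W2\<close>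
  lie in consecutive disjoint intervals.\<close>

lemma fill_compose:
  assumes W1: "fill p i \<alpha> W1" and W2: "fill p \<beta> j W2" and w: "w \<in> carrier F"
    and k: "\<And>k. p k \<in> tile w \<longleftrightarrow> \<alpha> \<le> k \<and> k \<le> \<beta>" and "i < \<alpha>" "\<alpha> \<le> \<beta>" "\<beta> < j"
  shows "fill p i j (insert w (W1 \<union> W2))"
  unfolding fill_def
proof (intro conjI ballI allI impI)
  show "finite (insert w (W1 \<union> W2))" "insert w (W1 \<union> W2) \<subseteq> carrier F"
    using W1 W2 w by (auto simp: fill_def)
next
  fix u assume u: "u \<in> insert w (W1 \<union> W2)"
  have r1: "i < k \<and> k < \<alpha>" if "u \<in> W1" "p k \<in> tile u" for k using fill_range[OF W1] that .
  have r2: "\<beta> < k \<and> k < j" if "u \<in> W2" "p k \<in> tile u" for k using fill_range[OF W2] that .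
  have range: "i < k \<and> k < j" if "p k \<in> tile u" for k
    using u that k[of k] r1[of k] r2[of k] assms(5-7) by auto
  have "\<exists>k. p k \<in> tile u"
    using u fillD(5)[OF W1, of u] fillD(5)[OF W2, of u] k[of \<alpha>] assms(6) by auto
  then show "\<exists>k>i. k < j \<and> p k \<in> tile u" using range by blast
  show "p i \<notin> tile u" "p j \<notin> tile u" using range by blast+
next
  fix m assume m: "i < m \<and> m < j"
  consider "m < \<alpha>" | "\<alpha> \<le> m \<and> m \<le> \<beta>" | "\<beta> < m" by linarith
  then show "\<exists>w\<in>insert w (W1 \<union> W2). p m \<in> tile w"
  proof cases
    case 1
    then show ?thesis using W1 m by (auto simp: fill_def)
  next
    case 2
    then show ?thesis using k by blast
  next
    case 3
    then show ?thesis using W2 m by (auto simp: fill_def)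
  qed
next
  fix u u' m assume u: "u \<in> insert w (W1 \<union> W2)" "u' \<in> insert w (W1 \<union> W2)" and m: "p m \<in> tile u \<and> p m \<in> tile u'"
  have r1: "m < \<alpha>" if "x \<in> W1" "p m \<in> tile x" for x using fill_range[OF W1 that] by simp
  have r2: "\<beta> < m" if "x \<in> W2" "p m \<in> tile x" for x using fill_range[OF W2 that] by simp
  consider "m < \<alpha>" | "\<alpha> \<le> m \<and> m \<le> \<beta>" | "\<beta> < m" by linarith
  then show "u = u'"
  proof cases
    case 1
    have "x \<in> W1" if "x \<in> insert w (W1 \<union> W2)" "p m \<in> tile x" for x
      using that 1 k[of m] r2[of x] assms(6) by auto
    then have "u \<in> W1" "u' \<in> W1" using u m by blast+
    then show ?thesis using fillD(7)[OF W1] m by blast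
  next
    case 2
    have "x = w" if "x \<in> insert w (W1 \<union> W2)" "p m \<in> tile x" for x
      using that 2 r1[of x] r2[of x] by auto
    then have "u = w" "u' = w" using u m by blast+
    then show ?thesis by simp
  next
    case 3
    have "x \<in> W2" if "x \<in> insert w (W1 \<union> W2)" "p m \<in> tile x" for x
      using that 3 k[of m] r1[of x] assms(6) by auto
    then have "u \<in> W2" "u' \<in> W2" using u m by blast+
    then show ?thesis using fillD(7)[OF W2] m by blast
  qed
qed

text \<open>If two tiles meet off the path, the median of a common point and of one path point of
  each tile lies in both tiles by convexity, and it lies on the path, where uniqueness is already
  known.\<close>

lemma fill_disjoint:
  assumes W: "fill p i j W" and w: "w \<in> W" "w' \<in> W" "tile w \<inter> tile w' \<noteq> {}"
  shows "w = w'"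
proof -
  obtain k where k1: "i < k \<and> k < j \<and> p k \<in> tile w" using fillD(5)[OF W w(1)] by (rule exE)
  obtain k' where k2: "i < k' \<and> k' < j \<and> p k' \<in> tile w'" using fillD(5)[OF W w(2)] by (rule exE)
  note k = k1[THEN conjunct2, THEN conjunct2] k2[THEN conjunct2, THEN conjunct2]
  obtain u where u: "u \<in> tile w" "u \<in> tile w'" using w by blast
  have wc: "w \<in> carrier F" "w' \<in> carrier F" using W w by (auto simp: fill_def)
  then have uc: "u \<in> carrier F" using u tile_closed by blast
  have c: "cnvx (tile w)" "cnvx (tile w')" using wc cnvx_tile by auto
  obtain m where m: "m \<in> seg u (p k)" "m \<in> seg (p k) (p k')" "m \<in> seg u (p k')"
    using median[OF uc p_closed p_closed] .
  have mm: "m \<in> tile w" "m \<in> tile w'" using m u k c unfolding cnvx_def by blast+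
  have "\<exists>n. m = p n"
  proof (cases "k \<le> k'")
    case True
    then show ?thesis using seg_walk[OF ray v True m(2)] by blast
  next
    case False
    then have "k' \<le> k" "m \<in> seg (p k') (p k)" using m(2) seg_commute by auto
    then show ?thesis using seg_walk[OF ray v] by metis
  qed
  then show ?thesis using fillD(7)[OF W w(1,2)] mm by blast
qed

lemma fill_empty: "fill p i (Suc i) {}"
  by (auto simp: fill_def)

lemma fill_straight:
  assumes "j - Suc i \<in> lengths l" "i < j" "\<And>k. i \<le> k \<Longrightarrow> k < j \<Longrightarrow> a k = l"
  obtains W where "fill p i j W"
proof -
  obtain ns where "set ns \<subseteq> linelen l ` S" "sum_list ns = j - Suc i"
    using assms(1) by (auto simp: lengths_def)
  then have "\<exists>W. fill p i j W" using assms(2,3)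
  proof (induction ns arbitrary: i)
    case Nil
    then have "j = Suc i" by simp
    then show ?case using fill_empty by blast
  next
    case (Cons q ns)
    have l: "fst l \<in> I" using Cons.prems(3) Cons.prems(4)[of i] a_closed[of i] by simp
    obtain s0 where s0: "s0 \<in> S" "linelen l s0 = q" using Cons.prems by auto
    have q: "q > 0" using s0 by (auto simp: linelen_def)
    \<comment> \<open>A point with \<open>q - 1\<close> steps ahead on a line of \<open>q\<close>
      points is its rear end. Placed at \<open>p (Suc i)\<close>, it makes the tile cover exactly
      the indices from \<open>Suc i\<close> to \<open>i + q\<close>.\<close>
    obtain l' k where "fst l' = fst l" "lp l' k s0 \<in> S" "fwd l (lp l' k s0) = q - 1"
      "linelen l (lp l' k s0) = q" using line_point[OF l s0(1), of "q - 1"] s0(2) q by (metis diff_less less_one)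
    moreover from this have "fwd (inv_letter l) (lp l' k s0) = 0" using s0 by (simp add: linelen_def)
    ultimately obtain s where s: "s \<in> S" "fwd l s = q - 1" "fwd (inv_letter l) s = 0"
      by blast
    have sum: "q + sum_list ns = j - Suc i" using Cons.prems by simp
    let ?w = "base_at s (p (Suc i))"
    have t: "p (Suc i + n) \<in> tile ?w \<longleftrightarrow> lp l n s \<in> S" if "Suc i + n \<le> j" for n
      using walk_straight[OF ray v, of "Suc i" n l] Cons.prems(4) that l s by (simp add: lp_mem_tile_at)
    have "p i = lp (inv_letter l) 1 (p (Suc i))"
      using walk_straight_back[OF ray v, of 1 "Suc i" l] Cons.prems(3,4) by simp
    then have "p i \<notin> tile ?w"
      using lp_mem_tile_at[of s "p (Suc i)" "inv_letter l" 1] fwd_out[of "inv_letter l" s] s l by simp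
    moreover have "p (Suc i) \<in> tile ?w" using s by (simp add: mem_tile_at)
    moreover have "p (i + q) \<in> tile ?w"
      using t[of "q - 1"] sum q fwd_in[OF l s(1), of "q - 1"] s by simp
    moreover have "p (Suc (i + q)) \<notin> tile ?w"
      using t[of q] sum q fwd_out[OF l s(1)] s Cons.prems(3) by simp
    ultimately have r: "p k \<in> tile ?w \<longleftrightarrow> Suc i \<le> k \<and> k \<le> i + q" for k
      using cnvx_range[of "tile ?w" "Suc i" "i + q" k] q s cnvx_tile by simp
    have "\<exists>W. fill p (i + q) j W"
      using Cons.prems sum by (intro Cons.IH) auto
    then obtain W where "fill p (i + q) j W" by blast
    from fill_compose[OF fill_empty this _ r] have "fill p i j (insert ?w ({} \<union> W))"
      using q sum s Cons.prems(3) by simp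
    then show ?case by blast
  qed
  then show thesis using that by blast
qed

lemma lengths_multiple: "s \<in> S \<Longrightarrow> n * linelen l s \<in> lengths l"
  unfolding lengths_def by (intro CollectI exI[of _ "replicate n (linelen l s)"])
    (auto simp: sum_list_replicate)

lemma fill_remainder:
  assumes "s \<in> S" "i < j" "\<And>k. i \<le> k \<Longrightarrow> k < j \<Longrightarrow> a k = l" "linelen l s dvd j - Suc i"
  obtains W where "fill p i j W"
proof -
  obtain n where "j - Suc i = n * linelen l s" using assms(4) by (metis dvd_def mult.commute)
  then show thesis using fill_straight[of j i l] lengths_multiple[OF assms(1)] assms(2,3) that by metis
qed

text \<open>At a turn, the position of the covering tile can be prescribed independently along the incoming
  and the outgoing line, leaving multiples of line lengths of \<open>S\<close> to be covered on straight parts.\<close>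

lemma fill_turn:
  assumes "i < j" "i < t" "t < j" "fst (a (t - 1)) \<noteq> fst (a t)"
  obtains W where "fill p i j W"
proof -
  have "\<exists>W. fill p i j W" using assms
  proof (induction "j - i" arbitrary: i t rule: less_induct)
    case less
    \<comment> \<open>The first turn. Since \<open>a k\<close> leads from \<open>p k\<close> to
      \<open>p (Suc k)\<close>, a turn at \<open>t\<close> is a change of generator between the
      letters \<open>t - 1\<close> and \<open>t\<close>.\<close>
    define t0 where "t0 = (LEAST t. i < t \<and> fst (a (t - 1)) \<noteq> fst (a t))"
    have t0: "i < t0" "fst (a (t0 - 1)) \<noteq> fst (a t0)" "t0 \<le> t"
      using LeastI[of "\<lambda>t. i < t \<and> fst (a (t - 1)) \<noteq> fst (a t)" t] less.prems
        Least_le[of "\<lambda>t. i < t \<and> fst (a (t - 1)) \<noteq> fst (a t)" t] by (auto simp: t0_def)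
    have same: "fst (a k) = fst (a (Suc k)) \<Longrightarrow> a (Suc k) = a k" for k
      using ray by (auto simp: ray_def prod_eq_iff inv_letter_def)
    define l where "l = a i"
    define l' where "l' = a t0"
    have l: "fst l \<in> I" "fst l' \<in> I" by (auto simp: l_def l'_def)
    have st: "a k = l" if "i \<le> k" "k < t0" for k
      using that
    proof (induction k rule: dec_induct)
      case (step k)
      have "fst (a k) = fst (a (Suc k))"
        using not_less_Least[of "Suc k" "\<lambda>t. i < t \<and> fst (a (t - 1)) \<noteq> fst (a t)"] step by (auto simp: t0_def)
      then show ?case using same[of k] step by simp
    qed (simp add: l_def)
    have ll': "fst l \<noteq> fst l'" using t0 st[of "t0 - 1"] by (simp add: l'_def)
    define str where "str \<longleftrightarrow> (\<forall>k. t0 \<le> k \<and> k < j \<longrightarrow> a k = l')"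
    \<comment> \<open>The tile reaches back by the remainder modulo its own line length, leaving a
      multiple of that length before it. If no turn follows \<open>t0\<close>, the same is done
      forwards; otherwise the tile ends at \<open>t0\<close>, and the rest, which contains another
      turn, is left to the induction. The two demands concern different generators, so
      \<open>choice_point\<close> can meet both.\<close>
    define c where "c m s \<longleftrightarrow>
        (m = fst l \<longrightarrow> fwd (inv_letter l) s = (t0 - Suc i) mod linelen l s) \<and>
        (m = fst l' \<longrightarrow> fwd l' s = (if str then (j - Suc t0) mod linelen l' s else 0))" for m s
    have pos: "linelen x s > 0" for x s by (simp add: linelen_def)
    have "\<exists>x k. fst x = m \<and> lp x k s \<in> S \<and> c m (lp x k s)" if m: "m \<in> I" "s \<in> S" for m s
    proof -
      consider "m = fst l" | "m = fst l'" | "m \<noteq> fst l" "m \<noteq> fst l'" by blast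
      then show ?thesis
      proof cases
        case 1
        obtain x k where "fst x = fst (inv_letter l)" "lp x k s \<in> S"
          "fwd (inv_letter l) (lp x k s) = (t0 - Suc i) mod linelen l s"
          "linelen (inv_letter l) (lp x k s) = linelen (inv_letter l) s"
          using line_point[of "inv_letter l" s "(t0 - Suc i) mod linelen l s"] l m pos
          by (auto simp: linelen_inv_letter)
        moreover from this have "c m (lp x k s)" using 1 ll' by (simp add: c_def linelen_inv_letter)
        ultimately show ?thesis using 1 by (metis inv_letter_simps(2))
      next
        case 2
        have lt: "(if str then (j - Suc t0) mod linelen l' s else 0) < linelen l' s" using pos by simp
        obtain x k where "fst x = fst l'" "lp x k s \<in> S"
          "fwd l' (lp x k s) = (if str then (j - Suc t0) mod linelen l' s else 0)"
          "linelen l' (lp x k s) = linelen l' s"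
          by (rule line_point[OF l(2) m(2) lt])
        moreover from this have "c m (lp x k s)" using 2 ll' by (simp add: c_def)
        ultimately show ?thesis using 2 by metis
      next
        case 3
        then have "c m (lp (m, True) 0 s)" "lp (m, True) 0 s \<in> S" using m by (auto simp: c_def)
        then show ?thesis by (metis fst_conv)
      qed
    qed
    then obtain s where s: "s \<in> S" "\<And>m. m \<in> I \<Longrightarrow> c m s" using choice_point by blast
    have bwd: "fwd (inv_letter l) s = (t0 - Suc i) mod linelen l s"
      and fore: "fwd l' s = (if str then (j - Suc t0) mod linelen l' s else 0)"
      using s(2)[of "fst l"] s(2)[of "fst l'"] l by (auto simp: c_def)
    define \<alpha> where "\<alpha> = t0 - fwd (inv_letter l) s"
    define \<beta> where "\<beta> = t0 + fwd l' s"
    have back_le: "fwd (inv_letter l) s \<le> t0 - Suc i" unfolding bwd by (rule mod_less_eq_dividend)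
    have forth_le: "fwd l' s \<le> j - Suc t0" unfolding fore by auto
    let ?w = "base_at s (p t0)"
    have bk: "p (t0 - n) = lp (inv_letter l) n (p t0)" if "n \<le> t0 - i" for n
    proof (cases "n = 0")
      case False
      then show ?thesis using walk_straight_back[OF ray v, of n t0 l] st that t0(1) by simp
    qed simp
    have bk': "p (t0 - n) \<in> tile ?w \<longleftrightarrow> lp (inv_letter l) n s \<in> S" if "n \<le> t0 - i" for n
      using bk[OF that] lp_mem_tile_at s l by simp
    have "p \<alpha> \<in> tile ?w"
      using bk'[of "fwd (inv_letter l) s"] fwd_in[of "inv_letter l" s] s l back_le by (simp add: \<alpha>_def)
    moreover have "p (\<alpha> - 1) \<notin> tile ?w"
      using bk'[of "Suc (fwd (inv_letter l) s)"] fwd_out[of "inv_letter l" s] s l back_le t0(1) by (simp add: \<alpha>_def)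
    moreover have fw: "p (t0 + n) \<in> tile ?w \<longleftrightarrow> lp l' n s \<in> S" if "\<forall>k. t0 \<le> k \<and> k < t0 + n \<longrightarrow> a k = l'" for n
      using walk_straight[OF ray v, of t0 n l'] that lp_mem_tile_at s l by simp
    have fwst: "\<forall>k. t0 \<le> k \<and> k < t0 + Suc (fwd l' s) \<longrightarrow> a k = l'"
    proof (cases str)
      case True
      then show ?thesis using forth_le less.prems t0 by (auto simp: str_def)
    next
      case False
      then show ?thesis using fore by (auto simp: l'_def less_Suc_eq_le dest: le_antisym)
    qed
    have "p \<beta> \<in> tile ?w" using fw[of "fwd l' s"] fwst fwd_in[of l' s] s l by (simp add: \<beta>_def)
    moreover have "p (Suc \<beta>) \<notin> tile ?w" using fw[OF fwst] fwd_out[of l' s] s l by (simp add: \<beta>_def)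
    moreover have ab: "i < \<alpha>" "\<alpha> \<le> \<beta>" "\<beta> < j"
      using back_le forth_le t0 less.prems by (auto simp: \<alpha>_def \<beta>_def)
    ultimately have r: "p k \<in> tile ?w \<longleftrightarrow> \<alpha> \<le> k \<and> k \<le> \<beta>" for k
      using cnvx_range[of "tile ?w" \<alpha> \<beta> k] cnvx_tile s by simp
    have "\<alpha> - Suc i = (t0 - Suc i) - (t0 - Suc i) mod linelen l s"
      unfolding \<alpha>_def bwd by simp
    then have "linelen l s dvd \<alpha> - Suc i" using dvd_minus_mod by metis
    then obtain W1 where W1: "fill p i \<alpha> W1" using fill_remainder[OF s(1), of i \<alpha> l] ab st by (auto simp: \<alpha>_def)
    have "\<exists>W. fill p \<beta> j W"
    proof (cases str)
      case True
      have "j - Suc \<beta> = (j - Suc t0) - (j - Suc t0) mod linelen l' s"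
        unfolding \<beta>_def fore using True by simp
      then have "linelen l' s dvd j - Suc \<beta>" using dvd_minus_mod by metis
      then show ?thesis using fill_remainder[OF s(1), of \<beta> j l'] ab True by (auto simp: str_def \<beta>_def)
    next
      case False
      then have \<beta>: "\<beta> = t0" using fore by (simp add: \<beta>_def)
      have "\<exists>t'. t0 < t' \<and> t' < j \<and> fst (a (t' - 1)) \<noteq> fst (a t')"
      proof (rule ccontr)
        assume no: "\<not> ?thesis"
        have "a k = l'" if "t0 \<le> k" "k < j" for k using that
        proof (induction k rule: dec_induct)
          case (step k)
          then have "fst (a k) = fst (a (Suc k))" using no by (auto dest: spec[of _ "Suc k"])
          then show ?case using same[of k] step by simp
        qed (simp add: l'_def)
        then show False using False by (auto simp: str_def)
      qed
      then show ?thesis using less.hyps[of t0] less.prems t0 \<beta> by (metis diff_less_mono2 less_le_trans le_less_trans)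
    qed
    then obtain W2 where "fill p \<beta> j W2" by blast
    from fill_compose[OF W1 this _ r ab] show ?case using s by auto
  qed
  then show thesis using that by blast
qed

lemma fill_exists:
  assumes "i < j" "\<And>l n. fst l \<in> I \<Longrightarrow> n \<ge> j - Suc i \<Longrightarrow> n \<in> lengths l"
  obtains W where "fill p i j W"
proof (cases "\<exists>t. i < t \<and> t < j \<and> fst (a (t - 1)) \<noteq> fst (a t)")
  case True
  then show thesis using fill_turn that assms(1) by metis
next
  case False
  have "a k = a i" if "i \<le> k" "k < j" for k using that
  proof (induction k rule: dec_induct)
    case (step k)
    then have "fst (a k) = fst (a (Suc k))" using False by (auto dest: spec[of _ "Suc k"])
    moreover have "a (Suc k) \<noteq> inv_letter (a k)" using ray by (simp add: ray_def)
    ultimately show ?case using step by (auto simp: prod_eq_iff inv_letter_def)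
  qed simp
  moreover have "j - Suc i \<in> lengths (a i)" using assms(2) by simp
  ultimately show thesis using fill_straight[of j i "a i"] assms(1) that by metis
qed

end

section \<open>Extending partial tilings\<close>

text \<open>Let \<open>d\<close> be the least positive difference of two sums. Division with
  remainder shows that \<open>d\<close> divides every element of \<open>A\<close>, so
  \<open>d = 1\<close>, and the consecutive sums \<open>y\<close> and \<open>y + 1\<close> generate
  everything from \<open>y * y\<close> on.\<close>

lemma sums_cofinite:
  fixes A :: "nat set"
  assumes q0: "q0 \<in> A" "q0 > 0" and gcd: "\<And>d. d > 1 \<Longrightarrow> \<exists>q\<in>A. \<not> d dvd q"
  obtains N where "\<And>n. n \<ge> N \<Longrightarrow> n \<in> {sum_list ns | ns. set ns \<subseteq> A}"
proof -
  define M where "M = {sum_list ns | ns. set ns \<subseteq> A}"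
  have add: "x + y \<in> M" if xy: "x \<in> M" "y \<in> M" for x y
  proof -
    obtain xs ys where "x = sum_list xs" "set xs \<subseteq> A" "y = sum_list ys" "set ys \<subseteq> A"
      using xy unfolding M_def by blast
    then show ?thesis unfolding M_def by (intro CollectI exI[of _ "xs @ ys"]) auto
  qed
  have AM: "q \<in> M" if "q \<in> A" for q
    using that unfolding M_def by (intro CollectI exI[of _ "[q]"]) auto
  have zero: "0 \<in> M" unfolding M_def by (intro CollectI exI[of _ "[]"]) auto
  have mult: "k * x \<in> M" if "x \<in> M" for k x
    using that zero add by (induction k) auto
  define P where "P d \<longleftrightarrow> d > 0 \<and> (\<exists>x\<in>M. \<exists>y\<in>M. x = y + d)" for d
  have "P q0" using q0 AM zero by (auto simp: P_def intro: bexI[of _ 0])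
  define d where "d = (LEAST d. P d)"
  have "P d" and least: "\<And>e. P e \<Longrightarrow> d \<le> e"
    using LeastI[of P q0] Least_le[of P] \<open>P q0\<close> by (auto simp: d_def)
  then obtain x y where xy: "x \<in> M" "y \<in> M" "x = y + d" "d > 0" by (auto simp: P_def)
  have "d dvd q" if q: "q \<in> A" for q
  proof (rule ccontr)
    assume nd: "\<not> d dvd q"
    let ?k = "q div d"
    have "q = ?k * d + q mod d" by simp
    then have "q + ?k * y = ?k * x + q mod d" using xy(3) by (simp add: algebra_simps)
    moreover have "q + ?k * y \<in> M" "?k * x \<in> M" using add mult xy AM q by blast+
    ultimately have "P (q mod d)" using nd by (auto simp: P_def dvd_eq_mod_eq_0)
    then show False using least[of "q mod d"] xy(4) by (meson mod_less_divisor not_le)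
  qed
  then have "d = 1" using gcd[of d] xy(4) by force
  have "n \<in> M" if n: "n \<ge> y * y" for n
  proof (cases "y = 0")
    case True
    then show ?thesis using mult[of 1 n] xy \<open>d = 1\<close> by simp
  next
    case False
    have "n mod y \<le> n div y"
    proof -
      have "n mod y < y" "y \<le> n div y" using div_le_mono[OF n, of y] False by auto
      then show ?thesis by linarith
    qed
    \<comment> \<open>The remainder is absorbed by using \<open>n mod y\<close> copies of
      \<open>y + 1\<close> in place of \<open>y\<close>; there are enough copies because
      \<open>y \<le> n div y\<close>.\<close>
    have "n = (n div y) * y + n mod y" by simp
    also have "\<dots> = (n div y - n mod y) * y + (n mod y) * (y + 1)"
      using \<open>n mod y \<le> n div y\<close> by (simp add: diff_mult_distrib algebra_simps)
    finally show ?thesis using add mult xy \<open>d = 1\<close> by metis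
  qed
  then show thesis using that by (auto simp: M_def)
qed

lemma (in free_basis) cnvxD: "cnvx K \<Longrightarrow> u \<in> K \<Longrightarrow> v \<in> K \<Longrightarrow> seg u v \<subseteq> K"
  by (simp add: cnvx_def)

context shape_ray
begin

text \<open>Every connection from \<open>K\<close> to a later point of the path passes through the
  exit \<open>p i\<close>. A tile of a \<open>fill\<close> that met \<open>K\<close> would thus
  contain \<open>p i\<close>, which it avoids; this keeps new tiles off old clusters.\<close>

lemma gate_ray:
  assumes K: "cnvx K" "z \<in> K" "p i \<in> K" "\<And>m. i < m \<Longrightarrow> m \<le> k \<Longrightarrow> p m \<notin> K" and "i \<le> k"
  shows "p i \<in> seg z (p k)"
proof (rule gate[OF K(1-3)])
  fix y assume y: "y \<in> seg (p i) (p k)" "y \<in> K"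
  obtain m where "i \<le> m" "m \<le> k" "y = p m" using seg_walk[OF ray v \<open>i \<le> k\<close> y(1)] .
  then show "y = p i" using K(4)[of m] y(2) by (cases "m = i") auto
qed simp

lemma gate_ray_end:
  assumes K: "cnvx K" "z \<in> K" "p j \<in> K" "\<And>m. k \<le> m \<Longrightarrow> m < j \<Longrightarrow> p m \<notin> K" and "k \<le> j"
  shows "p j \<in> seg z (p k)"
proof (rule gate[OF K(1-3)])
  fix y assume y: "y \<in> seg (p j) (p k)" "y \<in> K"
  have y': "y \<in> seg (p k) (p j)" using y(1) seg_commute[of "p j" "p k"] by simp
  obtain m where "k \<le> m" "m \<le> j" "y = p m" using seg_walk[OF ray v \<open>k \<le> j\<close> y'] .
  then show "y = p j" using K(4)[of m] y(2) by (cases "m = j") auto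
qed simp

end

context shape
begin

lemma finite_ball:
  assumes x: "x \<in> carrier F"
  shows "finite {u \<in> carrier F. gd x u \<le> R}"
proof (rule finite_subset)
  show "finite ((\<lambda>w. val w \<otimes> x) ` {w. set w \<subseteq> I \<times> UNIV \<and> length w \<le> R})"
    using finite_I by (intro finite_imageI finite_lists_length_le) auto
  show "{u \<in> carrier F. gd x u \<le> R} \<subseteq> (\<lambda>w. val w \<otimes> x) ` {w. set w \<subseteq> I \<times> UNIV \<and> length w \<le> R}"
  proof
    fix u assume u: "u \<in> {u \<in> carrier F. gd x u \<le> R}"
    let ?w = "nf (u \<otimes> inv x)"
    have "valid ?w" "val ?w = u \<otimes> inv x" "length ?w \<le> R" using nf u x by (auto simp: gd_def len_def)
    then show "u \<in> (\<lambda>w. val w \<otimes> x) ` {w. set w \<subseteq> I \<times> UNIV \<and> length w \<le> R}"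
      using u x by (intro image_eqI[of _ _ ?w]) (auto simp: m_assoc valid_def)
  qed
qed

definition cov :: "'f set \<Rightarrow> 'f set" where "cov W = (\<Union>w\<in>W. tile w)"

lemma cov_simps [simp]: "cov {} = {}" "cov (V \<union> W) = cov V \<union> cov W" "cov (insert w W) = tile w \<union> cov W"
  by (auto simp: cov_def)

lemma cov_closed: "W \<subseteq> carrier F \<Longrightarrow> cov W \<subseteq> carrier F"
  using tile_closed by (auto simp: cov_def)

definition packed :: "'f set \<Rightarrow> bool" where
  "packed W \<longleftrightarrow> W \<subseteq> carrier F \<and> (\<forall>w\<in>W. \<forall>w'\<in>W. tile w \<inter> tile w' \<noteq> {} \<longrightarrow> w = w')"

lemma packedD:
  "packed W \<Longrightarrow> w \<in> W \<Longrightarrow> w' \<in> W \<Longrightarrow> tile w \<inter> tile w' \<noteq> {} \<Longrightarrow> w = w'"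
  by (simp add: packed_def)

lemma packed_Un:
  assumes "packed V" "packed W" "cov V \<inter> cov W = {}"
  shows "packed (V \<union> W)"
  unfolding packed_def
proof (intro conjI ballI impI)
  show "V \<union> W \<subseteq> carrier F" using assms by (auto simp: packed_def)
  fix w w' assume w: "w \<in> V \<union> W" "w' \<in> V \<union> W" and ne: "tile w \<inter> tile w' \<noteq> {}"
  have "tile u \<subseteq> cov V" if "u \<in> V" for u using that by (auto simp: cov_def)
  moreover have "tile u \<subseteq> cov W" if "u \<in> W" for u using that by (auto simp: cov_def)
  ultimately have "w \<in> V \<and> w' \<in> V \<or> w \<in> W \<and> w' \<in> W" using w ne assms(3) by blast
  then show "w = w'" using packedD[OF assms(1) _ _ ne] packedD[OF assms(2) _ _ ne] by blast
qed

lemma (in shape_ray) packed_fill: "fill p i j W \<Longrightarrow> packed W"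
  unfolding packed_def
  by (intro conjI ballI impI) (rule fillD(2) fill_disjoint; assumption)+

end

section \<open>Separated patterns of tiles\<close>

locale prime_shape = shape F I f S
  for F :: "('f, 'b) monoid_scheme" (structure) and I :: "'i set" and f :: "'i \<Rightarrow> 'f" and S :: "'f set" +
  fixes N0 :: nat
  assumes N0: "fst l \<in> I \<Longrightarrow> n \<ge> N0 \<Longrightarrow> n \<in> lengths l"
begin

text \<open>Half of \<open>sep\<close> is a fillable gap \<open>Suc N0\<close>, the size
  \<open>diam\<close> of a tile, and the \<open>N0\<close> steps lost when a short path is prolonged
  in \<open>state_start\<close>.\<close>

definition sep :: nat where "sep = 2 * (Suc N0 + diam + N0)"

text \<open>Points of a growing cluster are within \<open>sep + diam\<close> of \<open>x\<close> or
  of old points in \<open>Y\<close>, and the next component to absorb is within \<open>sep\<close>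
  of the cluster; together this is the longest jump that must not leave \<open>Y\<close>.\<close>

definition wide :: nat where "wide = 2 * sep + diam"

text \<open>A piece may consist of several components; only its diameter and its distance to the
  rest of \<open>C\<close> matter.\<close>

definition isolated :: "nat \<Rightarrow> 'f set \<Rightarrow> 'f set \<Rightarrow> bool" where
  "isolated L C M \<longleftrightarrow> M \<subseteq> C \<and> (\<forall>u\<in>M. \<forall>v\<in>M. gd u v \<le> L) \<and> (\<forall>u\<in>M. \<forall>v\<in>C - M. wide < gd u v)"

text \<open>The second clause is the separation of components by more than \<open>sep\<close>,
  phrased without components: closer points are already joined inside the covered set.\<close>

definition good :: "nat \<Rightarrow> 'f set \<Rightarrow> bool" where
  "good L W \<longleftrightarrow> packed W \<and> (\<forall>u\<in>cov W. \<forall>v\<in>cov W. gd u v \<le> sep \<longrightarrow> seg u v \<subseteq> cov W) \<and>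
     (\<forall>u\<in>cov W. \<exists>M. u \<in> M \<and> isolated L (cov W) M)"

lemma goodD:
  assumes "good L W"
  shows "packed W" "u \<in> cov W \<Longrightarrow> v \<in> cov W \<Longrightarrow> gd u v \<le> sep \<Longrightarrow> seg u v \<subseteq> cov W"
    "u \<in> cov W \<Longrightarrow> \<exists>M. u \<in> M \<and> isolated L (cov W) M"
  using assms by (simp_all add: good_def)

lemma sep_pos: "sep \<ge> 2" "wide \<ge> sep" "wide \<ge> 1" "Suc N0 \<le> sep"
  by (auto simp: sep_def wide_def)

end

text \<open>The point \<open>x\<close> is to be covered. The cluster \<open>K\<close> around \<open>x\<close> grows by absorbing the nearest component of
  the covered set, until none is left within distance \<open>sep\<close>. As it stays close to \<open>Y\<close>, this ends.\<close>

locale cover_point = prime_shape F I f S N0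
  for F :: "('f, 'b) monoid_scheme" (structure) and I :: "'i set" and f :: "'i \<Rightarrow> 'f" and S :: "'f set"
    and N0 :: nat +
  fixes L :: nat and W0 :: "'f set" and x :: 'f
  assumes good: "good L W0" and x: "x \<in> carrier F" "x \<notin> cov W0"
begin

abbreviation C :: "'f set" where "C \<equiv> cov W0"

text \<open>A finite reservoir containing every old component that can be absorbed: by isolation,
  \<open>Y\<close> is closed under jumps of length at most \<open>wide\<close> inside
  \<open>C\<close>.\<close>

definition Y :: "'f set" where
  "Y = \<Union>{M. isolated L C M \<and> (\<exists>u\<in>M. gd x u \<le> wide)}"

lemma C_closed [simp]: "u \<in> C \<Longrightarrow> u \<in> carrier F"
  using good cov_closed[of W0] by (auto simp: good_def packed_def)

lemma C_subset: "C \<subseteq> carrier F"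
  by (auto intro: C_closed)

lemma Y_C: "Y \<subseteq> C"
  by (auto simp: Y_def isolated_def)

lemma Y_near_x: "u \<in> C \<Longrightarrow> gd x u \<le> wide \<Longrightarrow> u \<in> Y"
proof -
  assume u: "u \<in> C" "gd x u \<le> wide"
  obtain M where "u \<in> M" "isolated L C M" using goodD(3)[OF good u(1)] by blast
  then show "u \<in> Y" using u by (auto simp: Y_def)
qed

lemma Y_step: "u \<in> Y \<Longrightarrow> v \<in> C \<Longrightarrow> gd u v \<le> wide \<Longrightarrow> v \<in> Y"
proof -
  assume uv: "u \<in> Y" "v \<in> C" "gd u v \<le> wide"
  obtain M where M: "isolated L C M" "\<exists>u\<in>M. gd x u \<le> wide" "u \<in> M" using uv(1) by (auto simp: Y_def)
  have "v \<in> M" using M(1,3) uv(2,3) by (force simp: isolated_def)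
  then show "v \<in> Y" using M by (auto simp: Y_def)
qed

lemma Y_bound:
  assumes "u \<in> Y" shows "gd x u \<le> wide + L"
proof -
  obtain M t where M: "isolated L C M" "t \<in> M" "gd x t \<le> wide" "u \<in> M" using assms by (auto simp: Y_def)
  then have "gd t u \<le> L" "t \<in> C" "u \<in> C" by (auto simp: isolated_def)
  then show ?thesis using gd_triangle[of t x u] x M(3) by simp
qed

lemma finite_Y: "finite Y"
  by (rule finite_subset[OF _ finite_ball[OF x(1), of "wide + L"]]) (use Y_bound Y_C in auto)

text \<open>A path inside \<open>C\<close> proceeds by jumps of length 1, so it cannot leave
  \<open>Y\<close>.\<close>

lemma comp_Y:
  assumes "u \<in> Y" shows "comp C u \<subseteq> Y"
proof
  fix z assume z: "z \<in> comp C u"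
  have u: "u \<in> carrier F" using assms Y_C by auto
  have zc: "z \<in> carrier F" using z by (auto simp: comp_def)
  show "z \<in> Y"
  proof (cases "z = u")
    case False
    then obtain a where a: "ray a" "walk u a (gd u z) = z" using ray_exists u zc by metis
    have "walk u a k \<in> Y" if "k \<le> gd u z" for k
      using that
    proof (induction k)
      case (Suc k)
      have "walk u a (Suc k) \<in> seg (walk u a 0) (walk u a (gd u z))"
        by (rule walk_in_seg) (use a u Suc in auto)
      then have "walk u a (Suc k) \<in> C" using z a by (auto simp: comp_def)
      moreover have "gd (walk u a k) (walk u a (Suc k)) = 1" using gd_walk[OF a(1) u, of k "Suc k"] by simp
      ultimately show ?case using Suc Y_step[of "walk u a k" "walk u a (Suc k)"] sep_pos by simp
    qed (use assms in simp)
    then show ?thesis using a by force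
  qed (use assms in simp)
qed

lemma comp_far:
  assumes "u \<in> C" "z \<in> C" "z \<notin> comp C u" "t \<in> comp C u"
  shows "sep < gd z t"
proof (rule ccontr)
  assume "\<not> sep < gd z t"
  moreover have "t \<in> C" using assms by (auto simp: comp_def)
  ultimately have "seg t z \<subseteq> C" using good assms by (auto simp: good_def gd_commute)
  then show False using comp_step[OF C_subset assms(1) assms(4) assms(2)] assms(3) by blast
qed

text \<open>During growth the distance to the other clusters is only kept at \<open>Suc N0\<close>
  or more. This is what the next step needs: a straight gap of \<open>n \<ge> Suc N0\<close> edges
  has at least \<open>N0\<close> inner points and can be filled. The last clause keeps
  \<open>K\<close> near \<open>Y\<close>, so that the next component absorbed belongs to
  \<open>Y\<close>.\<close>

definition state :: "'f set \<Rightarrow> 'f set \<Rightarrow> bool" where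
  "state W K \<longleftrightarrow> finite W \<and> packed (W0 \<union> W) \<and> C \<inter> cov W = {} \<and> x \<in> cov W \<and> cnvx K \<and> cov W \<subseteq> K \<and> K \<subseteq> C \<union> cov W \<and>
     (\<forall>u\<in>C - K. \<forall>t\<in>K. Suc N0 \<le> gd u t) \<and> (\<forall>t\<in>K. \<exists>y\<in>insert x Y. gd y t \<le> sep + diam)"

text \<open>A single tile at \<open>x\<close> suffices if no covered point is within half of
  \<open>sep\<close>. Otherwise a tile at \<open>x\<close> might leave an unfillable gap, so the
  nearest component is joined to \<open>x\<close> at once.\<close>

lemma state_start: "\<exists>W K. state W K"
proof (cases "\<exists>u\<in>C. 2 * gd u x \<le> sep")
  case False
  obtain s where s: "s \<in> S" using S_nonempty by blast
  let ?w = "base_at s x"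
  have w: "?w \<in> carrier F" "x \<in> tile ?w" using s x by (auto simp: mem_tile_at)
  have far: "Suc N0 + diam < gd z x" if "z \<in> C" for z
    using False that by (force simp: sep_def)
  have tx: "gd x t \<le> diam" if "t \<in> tile ?w" for t using gd_tile w that by blast
  have tc: "t \<in> carrier F" if "t \<in> tile ?w" for t using tile_closed w that by blast
  have "C \<inter> tile ?w = {}" using far tx tc x by (force simp: gd_commute)
  then have "packed (W0 \<union> {?w})" using good w by (intro packed_Un) (auto simp: good_def packed_def)
  moreover have "Suc N0 \<le> gd u t" if "u \<in> C" "t \<in> tile ?w" for u t
    using gd_triangle[of t u x] far[OF that(1)] tx[OF that(2)] tc[OF that(2)] that x by (simp add: gd_commute)
  moreover have "gd x t \<le> sep + diam" if "t \<in> tile ?w" for t using tx[OF that] by simp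
  ultimately have "state {?w} (tile ?w)" using w \<open>C \<inter> tile ?w = {}\<close> by (auto simp: state_def cnvx_tile)
  then show ?thesis by blast
next
  case True
  then obtain u' where u': "u' \<in> C" "2 * gd u' x \<le> sep" by blast
  obtain u where u: "u \<in> C" and least: "\<And>z. z \<in> C \<Longrightarrow> gd u x \<le> gd z x"
    using ex_has_least_nat[of "\<lambda>z. z \<in> C" u' "\<lambda>z. gd z x"] u'(1) by blast
  define n where "n = gd u x"
  have n: "2 * n \<le> sep" using least[OF u'(1)] u'(2) by (simp add: n_def)
  have "u \<noteq> x" using u x by blast
  then obtain a where a: "ray a" "walk u a n = x" using ray_exists u x by (metis C_closed n_def)
  interpret shape_ray F I f S u a using a u by unfold_locales auto
  \<comment> \<open>The path from \<open>u\<close> to \<open>x\<close> may be too short to be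
    filled. Prolonged beyond \<open>x\<close>, it has \<open>n + N0\<close> inner points, with
    \<open>x = p n\<close> among them.\<close>
  define j where "j = n + Suc N0"
  obtain W where W: "fill p 0 j W"
    using fill_exists[of 0 j] N0 by (auto simp: j_def)
  define c where "c = comp C u"
  have c: "cnvx c" "u \<in> c" "c \<subseteq> C"
    using cnvx_comp[OF C_subset u] comp_self[OF C_subset u] comp_subset by (auto simp: c_def)
  \<comment> \<open>Before \<open>x\<close> this is minimality of \<open>u\<close>; a later return
    to the convex set \<open>c\<close> would put \<open>x\<close> into \<open>c\<close>.\<close>
  have pc: "p m \<notin> c" if "0 < m" for m
  proof
    assume m: "p m \<in> c"
    show False
    proof (cases "m < n")
      case True
      then have "gd (p m) x = n - m" using gd_walk[OF ray v, of m n] a(2) by simp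
      then show False using least[of "p m"] m c that True by (auto simp: n_def)
    next
      case False
      then have "p n \<in> c" using cnvx_between[OF c(1) _ m, of 0 n] c by simp
      then show False using a x c by auto
    qed
  qed
  have pk: "gd u (p k) = k" for k using gd_walk[OF ray v, of 0 k] by simp
  \<comment> \<open>Other components are more than \<open>sep\<close> away from \<open>u\<close>,
    while \<open>p k\<close> is at most \<open>n + N0\<close> away with
    \<open>2 * n \<le> sep\<close>; half of \<open>sep\<close> minus \<open>N0\<close>
    remains.\<close>
  have far: "Suc N0 + diam < gd z (p k)" if z: "z \<in> C" "z \<notin> c" and k: "k < j" for z k
  proof -
    have "sep < gd z u" using comp_far[OF u z(1)] z(2) comp_self[OF C_subset u] by (simp add: c_def)
    also have "gd z u \<le> gd z (p k) + gd (p k) u" using gd_triangle z u by simp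
    also have "gd (p k) u = k" using pk u by (simp add: gd_commute)
    finally show ?thesis using k n by (simp add: j_def sep_def)
  qed
  have Wt: "t \<in> carrier F \<and> (\<exists>k. 0 < k \<and> k < j \<and> gd t (p k) \<le> diam \<and> p 0 \<notin> seg t (p k) \<and> seg t (p k) \<subseteq> cov W)"
    if t: "t \<in> cov W" for t
  proof -
    obtain w where w: "w \<in> W" "t \<in> tile w" using t by (auto simp: cov_def)
    have wc: "w \<in> carrier F" using fillD(2)[OF W] w by blast
    obtain k where k: "0 < k \<and> k < j \<and> p k \<in> tile w" using fillD(5)[OF W w(1)] by (rule exE)
    have s: "seg t (p k) \<subseteq> tile w" using cnvx_tile[OF wc] w k by (simp add: cnvx_def)
    have "p 0 \<notin> tile w" using fillD(3)[OF W w(1)] .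
    then show ?thesis using s k w gd_tile[OF wc w(2)] tile_closed[OF wc] by (auto simp: cov_def)
  qed
  have disj: "C \<inter> cov W = {}"
  proof (rule ccontr)
    assume "C \<inter> cov W \<noteq> {}"
    then obtain z where z: "z \<in> C" "z \<in> cov W" by blast
    obtain k where k: "0 < k" "k < j" "gd z (p k) \<le> diam" "p 0 \<notin> seg z (p k)" using Wt[OF z(2)] by blast
    show False
    proof (cases "z \<in> c")
      case True
      then show False using gate_ray[OF c(1) True, of 0 k] c(2) pc k by auto
    next
      case False
      then show False using far[OF z(1) False k(2)] k(3) by simp
    qed
  qed
  define K where "K = c \<union> cov W"
  have "packed (W0 \<union> W)" using good packed_fill[OF W] disj by (intro packed_Un) (auto simp: good_def)
  moreover have "x \<in> cov W"
    using fillD(6)[OF W, of n] a(2) \<open>u \<noteq> x\<close> gd_eq_0[of u x] u x by (auto simp: cov_def j_def n_def)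
  moreover have path: "p k \<in> K" if "k < j" for k
    using fillD(6)[OF W, of k] that c by (cases "k = 0") (auto simp: cov_def K_def)
  have Kc: "K \<subseteq> carrier F" using c C_subset Wt by (auto simp: K_def)
  have "cnvx K"
  proof (rule cnvx_star[OF Kc])
    show "u \<in> K" using c by (simp add: K_def)
    fix z assume z: "z \<in> K"
    show "seg u z \<subseteq> K"
    proof (cases "z \<in> c")
      case True
      then show ?thesis using cnvxD[OF c(1,2)] by (auto simp: K_def)
    next
      case False
      then obtain k where k: "k < j" "seg z (p k) \<subseteq> cov W" using Wt z by (auto simp: K_def)
      have zc: "z \<in> carrier F" using Kc z by blast
      have "seg u (p k) \<subseteq> K"
      proof
        fix y assume "y \<in> seg u (p k)"
        then have "y \<in> seg (p 0) (p k)" by simp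
        then obtain m where "m \<le> k" "y = p m" using seg_walk[OF ray v, of 0 k] by blast
        then show "y \<in> K" using path k by simp
      qed
      moreover have "seg (p k) z \<subseteq> K" using k seg_commute[of z "p k"] zc by (auto simp: K_def)
      ultimately show ?thesis using seg_Un[of u z "p k"] u zc by auto
    qed
  qed
  moreover have "Suc N0 \<le> gd z t" if z: "z \<in> C - K" and t: "t \<in> K" for z t
  proof (cases "t \<in> c")
    case True
    then have "sep < gd z t" using comp_far[OF u, of z t] z by (auto simp: K_def c_def)
    then show ?thesis using sep_pos by simp
  next
    case False
    then obtain k where k: "k < j" "gd t (p k) \<le> diam" "t \<in> carrier F" using Wt t by (auto simp: K_def)
    have "Suc N0 + diam < gd z (p k)" using far[of z k] z k by (auto simp: K_def)
    also have "gd z (p k) \<le> gd z t + gd t (p k)" using gd_triangle k z by simp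
    finally show ?thesis using k by simp
  qed
  moreover have "u \<in> Y"
  proof (rule Y_near_x[OF u])
    have "gd x u = n" using u x by (simp add: n_def gd_commute)
    then show "gd x u \<le> wide" using n sep_pos by simp
  qed
  then have "\<exists>y\<in>insert x Y. gd y t \<le> sep + diam" if t: "t \<in> K" for t
  proof (cases "t \<in> c")
    case True
    then show ?thesis using comp_Y[OF \<open>u \<in> Y\<close>] c C_subset by (intro bexI[of _ t]) (auto simp: c_def)
  next
    case False
    then obtain k where k: "k < j" "gd t (p k) \<le> diam" "t \<in> carrier F" using Wt t by (auto simp: K_def)
    have "gd u t \<le> gd u (p k) + gd (p k) t" using gd_triangle u k by simp
    also have "\<dots> \<le> sep + diam" using k pk n by (simp add: gd_commute j_def sep_def)
    finally show ?thesis using \<open>u \<in> Y\<close> by blast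
  qed
  ultimately have "state W K" using fillD(1)[OF W] c disj by (auto simp: state_def K_def)
  then show ?thesis by blast
qed

text \<open>A nearest pair \<open>t\<close>, \<open>u\<close> is joined, so the interior of the path
  avoids both \<open>K1\<close> and \<open>C\<close>. The measure drops because \<open>u\<close>
  belongs to \<open>Y\<close> and enters the cluster together with its component.\<close>

lemma state_step:
  assumes st: "state W1 K1" and ex: "\<exists>u\<in>C - K1. \<exists>t\<in>K1. gd u t \<le> sep"
  shows "\<exists>W K. state W K \<and> card (Y - K) < card (Y - K1)"
proof -
  obtain u' t' where ut: "u' \<in> C - K1" "t' \<in> K1" "gd u' t' \<le> sep" using ex by blast
  obtain u t where u: "u \<in> C" "u \<notin> K1" and t: "t \<in> K1"
    and least: "\<And>z y. z \<in> C - K1 \<Longrightarrow> y \<in> K1 \<Longrightarrow> gd u t \<le> gd z y"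
    using ex_has_least_nat[of "\<lambda>(z, y). z \<in> C - K1 \<and> y \<in> K1" "(u', t')" "\<lambda>(z, y). gd z y"] ut(1,2)
    by auto
  have K1: "cnvx K1" "finite W1" "packed (W0 \<union> W1)" "x \<in> cov W1" "cov W1 \<subseteq> K1" "K1 \<subseteq> C \<union> cov W1"
      "C \<inter> cov W1 = {}"
    and gap1: "\<And>u t. u \<in> C - K1 \<Longrightarrow> t \<in> K1 \<Longrightarrow> Suc N0 \<le> gd u t"
    and near1: "\<And>t. t \<in> K1 \<Longrightarrow> \<exists>y\<in>insert x Y. gd y t \<le> sep + diam"
    using st by (auto simp: state_def)
  have K1c: "K1 \<subseteq> carrier F" using K1 by (simp add: cnvx_def)
  then have tc: "t \<in> carrier F" using t by blast
  define n where "n = gd t u"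
  have n': "n = gd u t" using u tc by (simp add: n_def gd_commute)
  have n: "n \<le> sep" using least[OF ut(1,2)] ut(3) n' by simp
  have nN: "Suc N0 \<le> n" using gap1[of u t] u t n' by simp
  have "u \<noteq> t" using u t by blast
  then obtain a where a: "ray a" "walk t a n = u" using ray_exists u tc by (metis C_closed n_def)
  interpret shape_ray F I f S t a using a tc by unfold_locales auto
  obtain W where W: "fill p 0 n W" using fill_exists[of 0 n] N0 nN by auto
  define c where "c = comp C u"
  have c: "cnvx c" "u \<in> c" "c \<subseteq> C"
    using cnvx_comp[OF C_subset u(1)] comp_self[OF C_subset u(1)] comp_subset by (auto simp: c_def)
  have pK: "p k \<notin> K1" if "0 < k" "k \<le> n" for k
  proof
    assume k: "p k \<in> K1"
    have "gd u (p k) = n - k" using gd_walk[OF ray v that(2)] a(2) u by (simp add: gd_commute)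
    then show False using least[of u "p k"] k u n' that nN by simp
  qed
  have pC: "p k \<notin> C" if "0 < k" "k < n" for k
  proof
    assume k: "p k \<in> C"
    have "gd (p k) t = k" using gd_walk[OF ray v, of 0 k] tc by (simp add: gd_commute)
    then show False using least[of "p k" t] k t pK[of k] n' that by simp
  qed
  \<comment> \<open>Two estimates are added: \<open>z\<close> is more than \<open>sep\<close> from
    \<open>u\<close>, and by minimality at least \<open>n\<close> from \<open>t\<close>. As
    \<open>p k\<close> divides the distance \<open>n\<close> between \<open>t\<close> and
    \<open>u\<close>, twice the distance from \<open>z\<close> to \<open>p k\<close> exceeds
    \<open>sep\<close>.\<close>
  have far: "Suc N0 + diam < gd z (p k)" if z: "z \<in> C" "z \<notin> c" "z \<notin> K1" and k: "k \<le> n" for z k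
  proof -
    have "sep < gd z u" using comp_far[OF u(1) z(1)] z(2) comp_self[OF C_subset u(1)] by (simp add: c_def)
    also have "gd z u \<le> gd z (p k) + gd (p k) u" using gd_triangle z u by simp
    also have "gd (p k) u = n - k" using gd_walk[OF ray v k] a(2) by simp
    finally have 1: "sep < gd z (p k) + (n - k)" .
    have "n \<le> gd z t" using least[of z t] z t n' by simp
    also have "gd z t \<le> gd z (p k) + gd (p k) t" using gd_triangle z tc by simp
    also have "gd (p k) t = k" using gd_walk[OF ray v, of 0 k] tc by (simp add: gd_commute)
    finally show ?thesis using 1 k by (simp add: sep_def)
  qed
  have Wt: "z \<in> carrier F \<and> (\<exists>k. 0 < k \<and> k < n \<and> gd z (p k) \<le> diam \<and> p 0 \<notin> seg z (p k) \<and>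
      p n \<notin> seg z (p k) \<and> seg z (p k) \<subseteq> cov W)"
    if z: "z \<in> cov W" for z
  proof -
    obtain w where w: "w \<in> W" "z \<in> tile w" using z by (auto simp: cov_def)
    have wc: "w \<in> carrier F" using fillD(2)[OF W] w by blast
    obtain k where k: "0 < k \<and> k < n \<and> p k \<in> tile w" using fillD(5)[OF W w(1)] by (rule exE)
    have s: "seg z (p k) \<subseteq> tile w" using cnvx_tile[OF wc] w k by (simp add: cnvx_def)
    have "p 0 \<notin> tile w" "p n \<notin> tile w" using fillD(3,4)[OF W w(1)] .
    then show ?thesis using s k w gd_tile[OF wc w(2)] tile_closed[OF wc]
      by (intro conjI exI[of _ k]) (auto simp: cov_def)
  qed
  have disj: "cov (W0 \<union> W1) \<inter> cov W = {}"
  proof (rule ccontr)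
    assume "cov (W0 \<union> W1) \<inter> cov W \<noteq> {}"
    then obtain z where z: "z \<in> C \<union> K1" "z \<in> cov W" using K1 by auto
    obtain k where k: "0 < k" "k < n" "gd z (p k) \<le> diam" "p 0 \<notin> seg z (p k)" "p n \<notin> seg z (p k)"
      using Wt[OF z(2)] by blast
    consider "z \<in> K1" | "z \<in> c" | "z \<in> C" "z \<notin> c" "z \<notin> K1" using z by blast
    then show False
    proof cases
      case 1
      then show False using gate_ray[OF K1(1) 1, of 0 k] t pK k by auto
    next
      case 2
      have "p m \<notin> c" if "k \<le> m" "m < n" for m using pC[of m] that k c by auto
      then have "p n \<in> seg z (p k)" using gate_ray_end[OF c(1) 2, of n k] c(2) a(2) k by simp
      then show False using k by blast
    next
      case 3
      then show False using far[OF 3, of k] k by simp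
    qed
  qed
  define K where "K = K1 \<union> c \<union> cov W"
  have "packed ((W0 \<union> W1) \<union> W)" by (rule packed_Un[OF K1(3) packed_fill[OF W] disj])
  then have "packed (W0 \<union> (W1 \<union> W))" by (simp add: Un_assoc)
  moreover have path: "p k \<in> K" if "k \<le> n" for k
    using fillD(6)[OF W, of k] that c t a(2) by (cases "k = 0"; cases "k = n") (auto simp: cov_def K_def)
  have Kc: "K \<subseteq> carrier F" using c C_subset K1c Wt by (auto simp: K_def)
  have pseg: "seg t (p k) \<subseteq> K" if "k \<le> n" for k
  proof
    fix y assume "y \<in> seg t (p k)"
    then have "y \<in> seg (p 0) (p k)" by simp
    then obtain m where "m \<le> k" "y = p m" using seg_walk[OF ray v, of 0 k] by blast
    then show "y \<in> K" using path that by simp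
  qed
  have "cnvx K"
  proof (rule cnvx_star[OF Kc])
    show "t \<in> K" using t by (simp add: K_def)
    fix z assume z: "z \<in> K"
    have zc: "z \<in> carrier F" using Kc z by blast
    consider "z \<in> K1" | "z \<in> c" | "z \<in> cov W" using z by (auto simp: K_def)
    then show "seg t z \<subseteq> K"
    proof cases
      case 1
      then show ?thesis using cnvxD[OF K1(1) t] by (auto simp: K_def)
    next
      case 2
      then have "seg u z \<subseteq> K" using cnvxD[OF c(1,2)] by (auto simp: K_def)
      moreover have "seg t u \<subseteq> K" using pseg[of n] a(2) by simp
      ultimately show ?thesis using seg_Un[of t z u] tc zc u by auto
    next
      case 3
      then obtain k where k: "k < n" "seg z (p k) \<subseteq> cov W" using Wt by blast
      then have "seg (p k) z \<subseteq> K" using seg_commute[of z "p k"] zc by (auto simp: K_def)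
      moreover have "seg t (p k) \<subseteq> K" using pseg k by simp
      ultimately show ?thesis using seg_Un[of t z "p k"] tc zc by auto
    qed
  qed
  moreover have "Suc N0 \<le> gd z y" if z: "z \<in> C - K" and y: "y \<in> K" for z y
  proof -
    consider "y \<in> K1" | "y \<in> c" | "y \<in> cov W" using y by (auto simp: K_def)
    then show ?thesis
    proof cases
      case 1
      then show ?thesis using gap1 z by (auto simp: K_def)
    next
      case 2
      then have "sep < gd z y" using comp_far[OF u(1), of z y] z by (auto simp: K_def c_def)
      then show ?thesis using sep_pos by simp
    next
      case 3
      then obtain k where k: "k < n" "gd y (p k) \<le> diam" "y \<in> carrier F" using Wt by blast
      have "Suc N0 + diam < gd z (p k)" using far[of z k] z k by (auto simp: K_def)
      also have "gd z (p k) \<le> gd z y + gd y (p k)" using gd_triangle k z by simp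
      finally show ?thesis using k by simp
    qed
  qed
  moreover have "u \<in> Y"
  proof -
    obtain y where y: "y \<in> insert x Y" "gd y t \<le> sep + diam" using near1 t by blast
    have yc: "y \<in> carrier F" using y(1) x Y_C by auto
    have "gd y u \<le> gd y t + gd t u" using gd_triangle yc tc u by simp
    then have "gd y u \<le> wide" using y n by (simp add: n_def wide_def)
    then show ?thesis using Y_near_x Y_step y(1) u by blast
  qed
  have "\<exists>y\<in>insert x Y. gd y z \<le> sep + diam" if z: "z \<in> K" for z
  proof -
    consider "z \<in> K1" | "z \<in> c" | "z \<in> cov W" using z by (auto simp: K_def)
    then show ?thesis
    proof cases
      case 1
      then show ?thesis using near1 by blast
    next
      case 2
      then show ?thesis using comp_Y[OF \<open>u \<in> Y\<close>] c C_subset by (intro bexI[of _ z]) (auto simp: c_def)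
    next
      case 3
      then obtain k where k: "k < n" "gd z (p k) \<le> diam" "z \<in> carrier F" using Wt by blast
      have "gd u z \<le> gd u (p k) + gd (p k) z" using gd_triangle u k by simp
      also have "gd u (p k) = n - k" using gd_walk[OF ray v, of k n] a(2) u k by (simp add: gd_commute)
      also have "gd (p k) z \<le> diam" using k by (simp add: gd_commute)
      finally have "gd u z \<le> sep + diam" using n by simp
      then show ?thesis using \<open>u \<in> Y\<close> by blast
    qed
  qed
  moreover have "C \<inter> cov (W1 \<union> W) = {}" using disj K1(7) by auto
  ultimately have "state (W1 \<union> W) K" using fillD(1)[OF W] c K1 by (auto simp: state_def K_def)
  moreover have "card (Y - K) < card (Y - K1)"
  proof (rule psubset_card_mono)
    show "finite (Y - K1)" using finite_Y by simp
    have "u \<in> Y - K1" "u \<notin> Y - K" using \<open>u \<in> Y\<close> u c by (auto simp: K_def)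
    moreover have "Y - K \<subseteq> Y - K1" by (auto simp: K_def)
    ultimately show "Y - K \<subset> Y - K1" by blast
  qed
  ultimately show ?thesis by blast
qed

text \<open>A state with the fewest points of \<open>Y\<close> outside \<open>K\<close> admits no
  further absorption, which raises the gap from \<open>Suc N0\<close> to more than
  \<open>sep\<close>.\<close>

lemma cover_point:
  obtains W K where "finite W" "packed (W0 \<union> W)" "C \<inter> cov W = {}" "x \<in> cov W" "cnvx K" "cov W \<subseteq> K" "K \<subseteq> C \<union> cov W"
    "\<And>u t. u \<in> C - K \<Longrightarrow> t \<in> K \<Longrightarrow> sep < gd u t"
    "\<And>t. t \<in> K \<Longrightarrow> gd x t \<le> wide + L + sep + diam"
proof -
  obtain W K where st: "state W K" and least: "\<And>W' K'. state W' K' \<Longrightarrow> card (Y - K) \<le> card (Y - K')"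
    using state_start ex_has_least_nat[of "\<lambda>(W, K). state W K" _ "\<lambda>(W, K). card (Y - K)"] by fastforce
  then have far: "sep < gd u t" if "u \<in> C - K" "t \<in> K" for u t
    using state_step[OF st] that by (meson not_le)
  have "gd x t \<le> wide + L + sep + diam" if t: "t \<in> K" for t
  proof -
    have "\<forall>t\<in>K. \<exists>y\<in>insert x Y. gd y t \<le> sep + diam" using st unfolding state_def by (elim conjE)
    then obtain y where y: "y \<in> insert x Y" "gd y t \<le> sep + diam" using t by blast
    have "gd x y \<le> wide + L" using y(1) Y_bound x by auto
    moreover have "y \<in> carrier F" "t \<in> carrier F"
      using y(1) x Y_C t st by (auto simp: state_def cnvx_def)
    ultimately show ?thesis using gd_triangle[of y x t] x y(2) by simp
  qed
  then show thesis using that st far by (auto simp: state_def)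
qed

end

context shape
begin

lemma mem_cov: "y \<in> cov W \<longleftrightarrow> (\<exists>w\<in>W. y \<in> tile w)"
  by (auto simp: cov_def)

lemma gd_mult_left: "y \<in> carrier F \<Longrightarrow> h \<in> carrier F \<Longrightarrow> gd h (y \<otimes> h) = len y"
  by (simp add: gd_def m_assoc)

lemma tile_mult_iff:
  assumes "w \<in> carrier F" "y \<in> carrier F" "h \<in> carrier F"
  shows "y \<otimes> h \<in> tile (w \<otimes> h) \<longleftrightarrow> y \<in> tile w"
  using assms by (simp add: mem_tile quotient_translate)

end

context prime_shape
begin

text \<open>Copies of one local extension, placed far apart at the points of \<open>P\<close> where \<open>W\<close> looks like \<open>W0\<close>.\<close>

lemma good_extend:
  fixes \<rho> R L :: nat
  assumes W': "packed (W0 \<union> W')" "cov W0 \<inter> cov W' = {}"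
    and K: "cnvx K" "cov W' \<subseteq> K" "K \<subseteq> cov W0 \<union> cov W'" "\<And>t. t \<in> K \<Longrightarrow> len t \<le> \<rho>"
    and Kfar: "\<And>u t. u \<in> cov W0 - K \<Longrightarrow> t \<in> K \<Longrightarrow> sep < gd u t"
    and W: "good L W"
    and P: "P \<subseteq> carrier F" "\<And>h h'. h \<in> P \<Longrightarrow> h' \<in> P \<Longrightarrow> h \<noteq> h' \<Longrightarrow> R < gd h h'"
    and same: "\<And>h g. h \<in> P \<Longrightarrow> g \<in> carrier F \<Longrightarrow> len g \<le> R \<Longrightarrow> g \<otimes> h \<in> W \<longleftrightarrow> g \<in> W0"
    and R: "R = 2 * (\<rho> + wide + L + diam)"
  shows "good (2 * (\<rho> + wide + L)) (W \<union> {w \<otimes> h | w h. w \<in> W' \<and> h \<in> P})"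
proof -
  define W2 where "W2 = {w \<otimes> h | w h. w \<in> W' \<and> h \<in> P}"
  have c: "W0 \<subseteq> carrier F" "W' \<subseteq> carrier F" "W \<subseteq> carrier F"
    using W'(1) goodD(1)[OF W] by (auto simp: packed_def)
  have Kc: "t \<in> carrier F" if "t \<in> K" for t using K(1) that by (auto simp: cnvx_def)
  have Pc: "h \<in> carrier F" if "h \<in> P" for h using P that by auto
  have W2c: "W2 \<subseteq> carrier F" using c Pc by (auto simp: W2_def)
  have covc: "cov W \<subseteq> carrier F" "cov W0 \<subseteq> carrier F" "cov W' \<subseteq> carrier F" using cov_closed c by auto
  have cov2I: "y \<otimes> h \<in> cov W2" if y: "y \<in> cov W'" and h: "h \<in> P" for y h
  proof -
    obtain w where w: "w \<in> W'" "y \<in> tile w" using y by (auto simp: mem_cov)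
    have "y \<otimes> h \<in> tile (w \<otimes> h)" using w c Pc[OF h] covc y by (subst tile_mult_iff) auto
    then show ?thesis using w h by (auto simp: mem_cov W2_def)
  qed
  have cov2E: "\<exists>y\<in>cov W'. \<exists>h\<in>P. z = y \<otimes> h" if z: "z \<in> cov W2" for z
  proof -
    obtain w h where w: "w \<in> W'" "h \<in> P" "z \<in> tile (w \<otimes> h)" using z by (auto simp: mem_cov W2_def)
    have "tile (w \<otimes> h) = (\<lambda>x. x \<otimes> h) ` tile w" using w c Pc by (intro tile_mult) auto
    then obtain y where "y \<in> tile w" "z = y \<otimes> h" using w by blast
    moreover from this have "y \<in> cov W'" using w by (auto simp: mem_cov)
    ultimately show ?thesis using w by blast
  qed
  \<comment> \<open>A point is covered only by tiles whose base is within \<open>diam\<close> of it,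
    so agreement of the bases up to \<open>R\<close> gives agreement of the covered sets up to
    \<open>R - diam\<close>.\<close>
  have agree: "y \<otimes> h \<in> cov W \<longleftrightarrow> y \<in> cov W0"
    if h: "h \<in> P" and y: "y \<in> carrier F" "len y + diam \<le> R" for y h
  proof -
    note hc = Pc[OF h]
    have short: "len g \<le> R" if g: "g \<in> carrier F" "y \<in> tile g" for g
    proof -
      have "gd g y \<le> diam" using gd_tile_base[OF g] .
      moreover have "gd \<one> g \<le> gd \<one> y + gd y g" using gd_triangle g y by simp
      ultimately show ?thesis using y g by (simp add: gd_commute[of y g]) (simp add: gd_def)
    qed
    show ?thesis
    proof
      assume "y \<otimes> h \<in> cov W"
      then obtain g where g: "g \<in> W" "y \<otimes> h \<in> tile g" by (auto simp: mem_cov)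
      let ?g = "g \<otimes> inv h"
      have gc: "g \<in> carrier F" "?g \<in> carrier F" "?g \<otimes> h = g" using g c hc by (auto simp: m_assoc)
      then have "y \<in> tile ?g" using g tile_mult_iff[of ?g y h] y hc by simp
      then have "?g \<in> W0" using same[OF h gc(2)] short gc g by simp
      then show "y \<in> cov W0" using \<open>y \<in> tile ?g\<close> by (auto simp: mem_cov)
    next
      assume "y \<in> cov W0"
      then obtain g where g: "g \<in> W0" "y \<in> tile g" by (auto simp: mem_cov)
      have gc: "g \<in> carrier F" using g c by auto
      then have "g \<otimes> h \<in> W" using same[OF h gc] short g by simp
      moreover have "y \<otimes> h \<in> tile (g \<otimes> h)" using tile_mult_iff g y gc hc by simp
      ultimately show "y \<otimes> h \<in> cov W" by (auto simp: mem_cov)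
    qed
  qed
  have KR: "len t + diam \<le> R" if "t \<in> K" for t using K(4)[OF that] R by simp
  have disj: "cov W \<inter> cov W2 = {}"
  proof (rule ccontr)
    assume "cov W \<inter> cov W2 \<noteq> {}"
    then obtain y h where yh: "y \<in> cov W'" "h \<in> P" "y \<otimes> h \<in> cov W" using cov2E by blast
    then have "y \<in> cov W0" using agree[OF yh(2), of y] KR K(2) Kc by blast
    then show False using W'(2) yh by blast
  qed
  \<comment> \<open>A chain of total length at most \<open>R\<close> cannot connect two different
    points of \<open>P\<close>; every possible interference of two copies is excluded in this
    way.\<close>
  have sameh: "h = h'" if "h \<in> P" "h' \<in> P" "gd h u \<le> k" "gd h' u' \<le> k'" "gd u u' \<le> n"
    "k + n + k' \<le> R" "u \<in> carrier F" "u' \<in> carrier F" for h h' u u' k k' n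
  proof (rule ccontr)
    assume "h \<noteq> h'"
    then have "R < gd h h'" using P that by blast
    also have "gd h h' \<le> gd h u + gd u h'" using gd_triangle that Pc by simp
    also have "gd u h' \<le> gd u u' + gd u' h'" using gd_triangle that Pc by simp
    also have "gd u' h' = gd h' u'" using gd_commute that Pc by simp
    finally show False using that by simp
  qed
  have gdK: "gd h (t \<otimes> h) \<le> \<rho>" if "t \<in> K" "h \<in> P" for t h
    using that K(4) gd_mult_left Kc Pc by simp
  have packed2: "packed W2" unfolding packed_def
  proof (intro conjI ballI impI)
    fix v v' assume v: "v \<in> W2" "v' \<in> W2" "tile v \<inter> tile v' \<noteq> {}"
    obtain w h where w: "v = w \<otimes> h" "w \<in> W'" "h \<in> P" using v by (auto simp: W2_def)
    obtain w' h' where w': "v' = w' \<otimes> h'" "w' \<in> W'" "h' \<in> P" using v by (auto simp: W2_def)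
    obtain q where "q \<in> tile v" "q \<in> tile v'" using v(3) by blast
    moreover have "tile v = (\<lambda>x. x \<otimes> h) ` tile w"
      unfolding w(1) by (rule tile_mult) (use w c Pc in auto)
    moreover have "tile v' = (\<lambda>x. x \<otimes> h') ` tile w'"
      unfolding w'(1) by (rule tile_mult) (use w' c Pc in auto)
    ultimately obtain y y' where y: "y \<in> tile w" "y' \<in> tile w'" "y \<otimes> h = y' \<otimes> h'" by auto
    have yK: "y \<in> K" "y' \<in> K" using y w w' K(2) by (auto simp: cov_def)
    have "h = h'"
    proof (rule sameh[of h h' "y \<otimes> h" \<rho> "y \<otimes> h" \<rho> 0])
      show "gd h (y \<otimes> h) \<le> \<rho>" using gdK yK w by simp
      show "gd h' (y \<otimes> h) \<le> \<rho>" using gdK[of y' h'] yK w' y(3) by simp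
    qed (use w w' yK Kc Pc R in auto)
    then have "y = y'" using y yK Kc Pc w by simp
    then have "w = w'" using packedD[OF W'(1), of w w'] w w' y by blast
    then show "v = v'" using w w' \<open>h = h'\<close> by simp
  qed (use W2c in simp)
  have 1: "packed (W \<union> W2)" using packed_Un goodD(1)[OF W] packed2 disj by blast
  \<comment> \<open>Old points near a copy of \<open>K\<close> are compared with \<open>W0\<close>,
    where \<open>K\<close> is separated from the rest; new points nearby belong to the same copy by
    \<open>sameh\<close>.\<close>
  have absorb: "\<exists>t'\<in>K. z = t' \<otimes> h"
    if t: "t \<in> K" "h \<in> P" and z: "z \<in> cov (W \<union> W2)" "gd (t \<otimes> h) z \<le> sep" for t h z
  proof (cases "z \<in> cov W")
    case True
    then have zc: "z \<in> carrier F" using covc by blast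
    let ?z = "z \<otimes> inv h"
    have zz: "?z \<in> carrier F" "?z \<otimes> h = z" using zc Pc t by (auto simp: m_assoc)
    have gdz: "gd t ?z \<le> sep" using z(2) gd_translate[of t ?z h] zz Kc Pc t by simp
    have "gd \<one> ?z \<le> gd \<one> t + gd t ?z" using gd_triangle Kc t zz by simp
    then have "len ?z \<le> \<rho> + sep" using K(4)[OF t(1)] gdz Kc t zz by (simp add: gd_def)
    then have "?z \<in> cov W0" using agree[OF t(2) zz(1)] True zz R sep_pos by simp
    moreover have "gd ?z t \<le> sep" using gdz gd_commute zz Kc t by simp
    ultimately have "?z \<in> K" using Kfar[of ?z t] t by (meson DiffI not_less)
    then show ?thesis using zz by metis
  next
    case False
    then obtain y h' where y: "y \<in> cov W'" "h' \<in> P" "z = y \<otimes> h'" using z cov2E[of z] by auto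
    have "y \<in> K" using y K by blast
    have "h = h'"
      by (rule sameh[of h h' "t \<otimes> h" \<rho> z \<rho> sep])
        (use t y \<open>y \<in> K\<close> z gdK Kc Pc R sep_pos in auto)
    then show ?thesis using y \<open>y \<in> K\<close> by blast
  qed
  have Kh: "t \<otimes> h \<in> cov (W \<union> W2)" if t: "t \<in> K" "h \<in> P" for t h
    using K(3) t agree[OF t(2) Kc[OF t(1)] KR[OF t(1)]] cov2I by auto
  have segK: "seg (t \<otimes> h) z \<subseteq> cov (W \<union> W2)"
    if t: "t \<in> K" "h \<in> P" and z: "z \<in> cov (W \<union> W2)" "gd (t \<otimes> h) z \<le> sep" for t h z
  proof
    fix y assume y: "y \<in> seg (t \<otimes> h) z"
    then have yc: "y \<in> carrier F" using seg_subset by blast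
    obtain t' where t': "t' \<in> K" "z = t' \<otimes> h" using absorb[OF t z] by blast
    let ?y = "y \<otimes> inv h"
    have yy: "?y \<in> carrier F" "?y \<otimes> h = y" using yc Pc t by (auto simp: m_assoc)
    then have "?y \<in> seg t t'" using y t' seg_translate[of t t' ?y h] Kc Pc t by simp
    then have "?y \<in> K" using cnvxD[OF K(1) t(1) t'(1)] by blast
    then show "y \<in> cov (W \<union> W2)" using Kh[of ?y h] yy t by simp
  qed
  have covWc: "z \<in> carrier F" if "z \<in> cov (W \<union> W2)" for z
    using that cov_closed[of "W \<union> W2"] c W2c by blast
  have 2: "seg u v \<subseteq> cov (W \<union> W2)"
    if uv: "u \<in> cov (W \<union> W2)" "v \<in> cov (W \<union> W2)" "gd u v \<le> sep" for u v
  proof -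
    consider "u \<in> cov W" "v \<in> cov W" | "u \<in> cov W2" | "v \<in> cov W2" using uv by auto
    then show ?thesis
    proof cases
      case 1
      then show ?thesis using goodD(2)[OF W] uv by auto
    next
      case 2
      then obtain y h where "y \<in> cov W'" "h \<in> P" "u = y \<otimes> h" using cov2E by blast
      then show ?thesis using segK[of y h v] uv K by blast
    next
      case 3
      then obtain y h where "y \<in> cov W'" "h \<in> P" "v = y \<otimes> h" using cov2E by blast
      moreover have "gd v u \<le> sep" "seg u v = seg v u" using uv covWc gd_commute seg_commute by auto
      ultimately show ?thesis using segK[of y h u] uv K by blast
    qed
  qed
  \<comment> \<open>The new piece at \<open>h\<close> merges the copy of \<open>W'\<close> with all
    old pieces within \<open>wide\<close> of it. Its radius about \<open>h\<close> is at most
    \<open>\<rho> + wide + L\<close>, whence the new bound.\<close>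
  define M where "M h = (\<lambda>y. y \<otimes> h) ` cov W' \<union>
    \<Union>{N. isolated L (cov W) N \<and> (\<exists>u\<in>N. \<exists>y\<in>cov W'. gd (y \<otimes> h) u \<le> wide)}" for h
  have Msub: "M h \<subseteq> cov (W \<union> W2)" if "h \<in> P" for h
    using cov2I[OF _ that] by (auto simp: M_def isolated_def)
  have Mball: "gd h u \<le> \<rho> + wide + L" if h: "h \<in> P" and u: "u \<in> M h" for h u
  proof -
    consider y where "y \<in> cov W'" "u = y \<otimes> h"
      | N u' y where "isolated L (cov W) N" "u \<in> N" "u' \<in> N" "y \<in> cov W'" "gd (y \<otimes> h) u' \<le> wide"
      using u unfolding M_def by blast
    then show ?thesis
    proof cases
      case 1
      then show ?thesis using gdK[of y h] h K by fastforce
    next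
      case 2
      then have u': "u' \<in> carrier F" "u \<in> carrier F" "gd u' u \<le> L" using covc by (auto simp: isolated_def)
      have y: "y \<in> K" "y \<in> carrier F" using 2 K Kc by auto
      have "gd h u \<le> gd h u' + gd u' u" using gd_triangle u' Pc h by simp
      moreover have "gd h u' \<le> gd h (y \<otimes> h) + gd (y \<otimes> h) u'" using gd_triangle u' Pc h y by simp
      ultimately show ?thesis using u' gdK[OF y(1) h] 2 by simp
    qed
  qed
  have Miso: "isolated (2 * (\<rho> + wide + L)) (cov (W \<union> W2)) (M h)" if h: "h \<in> P" for h
    unfolding isolated_def
  proof (intro conjI ballI)
    show "M h \<subseteq> cov (W \<union> W2)" using Msub h .
    fix u assume u: "u \<in> M h"
    then have uc: "u \<in> carrier F" using Msub[OF h] covWc by blast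
    { fix v assume v: "v \<in> M h"
      then have vc: "v \<in> carrier F" using Msub[OF h] covWc by blast
      have "gd u v \<le> gd u h + gd h v" using gd_triangle uc vc Pc[OF h] by simp
      also have "gd u h = gd h u" using gd_commute uc Pc[OF h] by simp
      finally show "gd u v \<le> 2 * (\<rho> + wide + L)" using Mball[OF h u] Mball[OF h v] by simp }
    fix v assume v: "v \<in> cov (W \<union> W2) - M h"
    have vc: "v \<in> carrier F" using v covWc by blast
    show "wide < gd u v"
    proof (rule ccontr)
      assume "\<not> wide < gd u v"
      then have le: "gd u v \<le> wide" by simp
      show False
      proof (cases "v \<in> cov W")
        case True
        consider y where "y \<in> cov W'" "u = y \<otimes> h"
          | N u' y where "isolated L (cov W) N" "u \<in> N" "u' \<in> N" "y \<in> cov W'" "gd (y \<otimes> h) u' \<le> wide"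
          using u unfolding M_def by blast
        then show False
        proof cases
          case 1
          obtain N where "v \<in> N" "isolated L (cov W) N" using goodD(3)[OF W True] by blast
          then have "v \<in> M h" using 1 le unfolding M_def by blast
          then show False using v by blast
        next
          case 2
          then have "v \<in> N" using le True unfolding isolated_def by (meson DiffI not_less)
          then have "v \<in> M h" using 2 unfolding M_def by blast
          then show False using v by blast
        qed
      next
        case False
        then obtain y h' where y: "y \<in> cov W'" "h' \<in> P" "v = y \<otimes> h'" using v cov2E[of v] by auto
        have "h = h'"
          by (rule sameh[of h h' u "\<rho> + wide + L" v \<rho> wide])
            (use h y Mball[OF h u] gdK[of y h'] K(2) le uc vc R in auto)
        then have "v \<in> M h" using y by (auto simp: M_def)
        then show False using v by blast
      qed
    qed
  qed
  have 3: "\<exists>N. u \<in> N \<and> isolated (2 * (\<rho> + wide + L)) (cov (W \<union> W2)) N"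
    if u: "u \<in> cov (W \<union> W2)" for u
  proof (cases "\<exists>h\<in>P. u \<in> M h")
    case True
    then show ?thesis using Miso by blast
  next
    case False
    have uW: "u \<in> cov W"
    proof (rule ccontr)
      assume "u \<notin> cov W"
      then obtain y h where "y \<in> cov W'" "h \<in> P" "u = y \<otimes> h" using u cov2E[of u] by auto
      then show False using False by (auto simp: M_def)
    qed
    obtain N where N: "u \<in> N" "isolated L (cov W) N" using goodD(3)[OF W uW] by blast
    have Ns: "N \<subseteq> cov W" using N by (simp add: isolated_def)
    have "isolated (2 * (\<rho> + wide + L)) (cov (W \<union> W2)) N"
      unfolding isolated_def
    proof (intro conjI ballI)
      show "N \<subseteq> cov (W \<union> W2)" using Ns by auto
      fix u' assume u': "u' \<in> N"
      show "gd u' v \<le> 2 * (\<rho> + wide + L)" if "v \<in> N" for v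
      proof -
        have "gd u' v \<le> L" using N(2) u' that by (simp add: isolated_def)
        then show ?thesis by simp
      qed
      fix v assume v: "v \<in> cov (W \<union> W2) - N"
      show "wide < gd u' v"
      proof (cases "v \<in> cov W")
        case True
        then show ?thesis using N(2) u' v unfolding isolated_def by blast
      next
        case nv: False
        show ?thesis
        proof (rule ccontr)
          assume "\<not> wide < gd u' v"
          moreover have "u' \<in> carrier F" "v \<in> carrier F" using u' v Ns covWc covc by auto
          ultimately have le: "gd v u' \<le> wide" using gd_commute by simp
          obtain y h where y: "y \<in> cov W'" "h \<in> P" "v = y \<otimes> h" using v nv cov2E[of v] by auto
          then have "u \<in> M h" using N u' le unfolding M_def by blast
          then show False using False y by blast
        qed
      qed
    qed
    then show ?thesis using N by blast
  qed
  have "good (2 * (\<rho> + wide + L)) (W \<union> W2)" using 1 2 3 by (simp add: good_def del: cov_simps)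
  then show ?thesis by (simp only: W2_def)
qed

lemma good_empty: "good L {}"
  by (simp add: good_def packed_def)

end

section \<open>Generic tilings of a space\<close>

locale tiling_action = prime_shape F I f S N0
  for F :: "('f, 'b) monoid_scheme" (structure) and I :: "'i set" and f :: "'i \<Rightarrow> 'f" and S :: "'f set"
    and N0 :: nat +
  fixes \<psi> :: "'f \<Rightarrow> 'x::polish_space \<Rightarrow> 'x"
  assumes action_one: "\<psi> \<one> z = z"
    and action_mult: "g \<in> carrier F \<Longrightarrow> h \<in> carrier F \<Longrightarrow> \<psi> (g \<otimes> h) z = \<psi> g (\<psi> h z)"
    and action_cont: "g \<in> carrier F \<Longrightarrow> continuous_on UNIV (\<psi> g)"
    and action_free: "open U \<Longrightarrow> U \<noteq> {} \<Longrightarrow> \<exists>y\<in>U. \<forall>g\<in>carrier F. g \<noteq> \<one> \<longrightarrow> \<psi> g y \<noteq> y"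
begin

text \<open>The bases of the tiles on the orbit of \<open>z\<close>, recorded as group elements
  rather than as points; moving \<open>z\<close> along its orbit right-translates this set, and a
  nontrivial stabiliser makes it periodic.\<close>

definition hits :: "'x set \<Rightarrow> 'x \<Rightarrow> 'f set" where
  "hits V z = {g \<in> carrier F. \<psi> g z \<in> V}"

text \<open>One bound \<open>L\<close> serves all points \<open>z\<close>, so that a single radius
  can be used for all orbits when the pattern is extended.\<close>

definition tiler :: "nat \<Rightarrow> 'x set \<Rightarrow> bool" where
  "tiler L V \<longleftrightarrow> open V \<and> (\<forall>z. good L (hits V z))"

lemma action_inv: "g \<in> carrier F \<Longrightarrow> \<psi> (inv g) (\<psi> g z) = z" "g \<in> carrier F \<Longrightarrow> \<psi> g (\<psi> (inv g) z) = z"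
  using action_mult[of "inv g" g z] action_mult[of g "inv g" z] by (auto simp: action_one)

lemma action_image: "g \<in> carrier F \<Longrightarrow> \<psi> g ` U = \<psi> (inv g) -` U"
  by (auto simp: action_inv intro!: image_eqI[of _ _ "\<psi> (inv g) _"])

lemma action_open: "g \<in> carrier F \<Longrightarrow> open U \<Longrightarrow> open (\<psi> g ` U)"
  using action_image[of g U] action_cont[of "inv g"] by (simp add: open_vimage)

text \<open>The elements \<open>g\<close> are treated in turn: either the current open set has no
  point moved into \<open>V\<close>, or the points that are moved into \<open>V\<close> form a
  smaller nonempty open set.\<close>

lemma constant_pattern:
  assumes "finite A" "A \<subseteq> carrier F" "open V" "open B" "B \<noteq> {}"
  shows "\<exists>B'\<subseteq>B. open B' \<and> B' \<noteq> {} \<and> (\<forall>g\<in>A. (\<forall>y\<in>B'. \<psi> g y \<in> V) \<or> (\<forall>y\<in>B'. \<psi> g y \<notin> V))"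
  using assms(1,2)
proof (induction A rule: finite_induct)
  case empty
  then show ?case using assms by auto
next
  case (insert g A)
  then obtain B' where B': "B' \<subseteq> B" "open B'" "B' \<noteq> {}"
    "\<forall>g\<in>A. (\<forall>y\<in>B'. \<psi> g y \<in> V) \<or> (\<forall>y\<in>B'. \<psi> g y \<notin> V)" by auto
  show ?case
  proof (cases "B' \<inter> \<psi> g -` V = {}")
    case True
    then show ?thesis using B' by (intro exI[of _ B']) auto
  next
    case False
    have "open (B' \<inter> \<psi> g -` V)" using B' assms insert action_cont by (auto intro!: open_vimage)
    then show ?thesis using B' False by (intro exI[of _ "B' \<inter> \<psi> g -` V"]) auto
  qed
qed

lemma separated_nbhd:
  assumes "finite A" "A \<subseteq> carrier F" "\<And>g. g \<in> A \<Longrightarrow> \<psi> g y \<noteq> y" "open B" "y \<in> B"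
  shows "\<exists>B'\<subseteq>B. open B' \<and> y \<in> B' \<and> (\<forall>g\<in>A. \<forall>z\<in>B'. \<psi> g z \<notin> B')"
  using assms(1,2,3)
proof (induction A rule: finite_induct)
  case empty
  then show ?case using assms by auto
next
  case (insert g A)
  then obtain B' where B': "B' \<subseteq> B" "open B'" "y \<in> B'" "\<forall>g\<in>A. \<forall>z\<in>B'. \<psi> g z \<notin> B'" by auto
  obtain U V where UV: "open U" "open V" "\<psi> g y \<in> U" "y \<in> V" "U \<inter> V = {}"
    using hausdorff[of "\<psi> g y" y] insert by auto
  have "open (B' \<inter> V \<inter> \<psi> g -` U)" using B' UV insert action_cont by (auto intro!: open_vimage)
  moreover have "\<forall>z \<in> B' \<inter> V \<inter> \<psi> g -` U. \<psi> g z \<notin> B' \<inter> V \<inter> \<psi> g -` U" using UV by blast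
  ultimately show ?case using B' UV by (intro exI[of _ "B' \<inter> V \<inter> \<psi> g -` U"]) auto
qed

lemma tiler_extend:
  assumes V: "tiler L V" and U: "open U" "U \<noteq> {}"
  shows "\<exists>V' L'. V \<subseteq> V' \<and> tiler L' V' \<and> (\<exists>s\<in>S. \<exists>v\<in>V'. \<psi> s v \<in> U)"
proof (cases "\<exists>s\<in>S. \<exists>v\<in>V. \<psi> s v \<in> U")
  case True
  then show ?thesis using V by blast
next
  case False
  \<comment> \<open>\<open>\<rho>\<close> is the radius of the new cluster supplied by
    \<open>cover_point\<close>; \<open>R\<close> is both the window to be compared and the spacing
    of the copies required by \<open>good_extend\<close>.\<close>
  define \<rho> where "\<rho> = wide + L + sep + diam"
  define R where "R = 2 * (\<rho> + wide + L + diam)"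
  define A where "A = {g \<in> carrier F. gd \<one> g \<le> R}"
  have A: "finite A" "A \<subseteq> carrier F" using finite_ball[of \<one>] by (auto simp: A_def)
  have lenA: "g \<in> A \<longleftrightarrow> len g \<le> R" if "g \<in> carrier F" for g using that by (simp add: A_def gd_def)
  have Vo: "open V" using V by (simp add: tiler_def)
  \<comment> \<open>\<open>B0\<close> makes the pattern within \<open>R\<close> constant, so the
    extension computed at the single free point \<open>y\<close> fits at all its points. Shrinking
    to \<open>B\<close>, to which no nontrivial element of length at most \<open>R\<close> returns,
    keeps the copies more than \<open>R\<close> apart.\<close>
  obtain B0 where B0: "B0 \<subseteq> U" "open B0" "B0 \<noteq> {}"
    "\<forall>g\<in>A. (\<forall>y\<in>B0. \<psi> g y \<in> V) \<or> (\<forall>y\<in>B0. \<psi> g y \<notin> V)"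
    using constant_pattern[OF A Vo U] by blast
  obtain y where y: "y \<in> B0" "\<And>g. g \<in> carrier F \<Longrightarrow> g \<noteq> \<one> \<Longrightarrow> \<psi> g y \<noteq> y"
    using action_free[OF B0(2,3)] by blast
  obtain B where B: "B \<subseteq> B0" "open B" "y \<in> B" "\<forall>g\<in>A - {\<one>}. \<forall>z\<in>B. \<psi> g z \<notin> B"
    using separated_nbhd[of "A - {\<one>}" y B0] A y B0 by blast
  define W0 where "W0 = hits V y"
  have W0: "good L W0" using V by (simp add: tiler_def W0_def)
  have nc: "\<one> \<notin> cov W0"
  proof
    assume "\<one> \<in> cov W0"
    then obtain g where g: "g \<in> carrier F" "\<psi> g y \<in> V" "\<one> \<in> tile g" by (auto simp: mem_cov W0_def hits_def)
    then obtain s where s: "s \<in> S" "\<one> = s \<otimes> g" by (auto simp: tile_def)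
    have "\<psi> s (\<psi> g y) = y" using action_mult[of s g y] s g action_one by simp
    then show False using False s g y B0 by (metis subsetD)
  qed
  interpret cover_point F I f S N0 L W0 \<one>
    using W0 nc by unfold_locales auto
  obtain W' K where W': "finite W'" "packed (W0 \<union> W')" "cov W0 \<inter> cov W' = {}" "\<one> \<in> cov W'" "cnvx K"
    "cov W' \<subseteq> K" "K \<subseteq> cov W0 \<union> cov W'" "\<And>u t. u \<in> cov W0 - K \<Longrightarrow> t \<in> K \<Longrightarrow> sep < gd u t"
    "\<And>t. t \<in> K \<Longrightarrow> gd \<one> t \<le> wide + L + sep + diam"
    using cover_point by metis
  have W'c: "W' \<subseteq> carrier F" using W'(2) by (auto simp: packed_def)
  have Klen: "len t \<le> \<rho>" if "t \<in> K" for t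
    using W'(9)[OF that] W'(5) that by (auto simp: \<rho>_def gd_def cnvx_def)
  define V' where "V' = V \<union> (\<Union>w\<in>W'. \<psi> w ` B)"
  have "open V'" unfolding V'_def using Vo W'c B(2) action_open by (intro open_Un open_UN) auto
  moreover have "good (2 * (\<rho> + wide + L)) (hits V' z)" for z
  proof -
    let ?P = "hits B z"
    have "hits V' z = hits V z \<union> {w \<otimes> h | w h. w \<in> W' \<and> h \<in> ?P}"
    proof (intro equalityI subsetI)
      fix g assume g: "g \<in> hits V' z"
      show "g \<in> hits V z \<union> {w \<otimes> h | w h. w \<in> W' \<and> h \<in> ?P}"
      proof (cases "g \<in> hits V z")
        case False
        then obtain w b where w: "g \<in> carrier F" "w \<in> W'" "b \<in> B" "\<psi> g z = \<psi> w b"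
          using g by (auto simp: hits_def V'_def)
        let ?h = "inv w \<otimes> g"
        have wc: "w \<in> carrier F" using w W'c by auto
        have "\<psi> ?h z = b" using w wc action_mult[of "inv w" g z] action_inv by simp
        then have "?h \<in> ?P" using w wc by (simp add: hits_def)
        moreover have "g = w \<otimes> ?h" using w wc by (simp add: m_assoc[symmetric])
        ultimately show ?thesis using w by blast
      qed simp
    next
      fix g assume "g \<in> hits V z \<union> {w \<otimes> h | w h. w \<in> W' \<and> h \<in> ?P}"
      then consider "g \<in> hits V z" | w h where "g = w \<otimes> h" "w \<in> W'" "h \<in> ?P" by blast
      then show "g \<in> hits V' z"
      proof cases
        case 1
        then show ?thesis by (auto simp: hits_def V'_def)
      next
        case 2
        then have c: "w \<in> carrier F" "h \<in> carrier F" "\<psi> h z \<in> B" using W'c by (auto simp: hits_def)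
        then have "\<psi> g z \<in> \<psi> w ` B" using action_mult 2 by simp
        then show ?thesis using 2 c by (auto simp: hits_def V'_def)
      qed
    qed
    moreover have "good (2 * (\<rho> + wide + L)) (hits V z \<union> {w \<otimes> h | w h. w \<in> W' \<and> h \<in> ?P})"
    proof (rule good_extend[OF W'(2,3,5,6,7) Klen W'(8)])
      show "good L (hits V z)" using V by (simp add: tiler_def)
      show "?P \<subseteq> carrier F" by (auto simp: hits_def)
      show "R = 2 * (\<rho> + wide + L + diam)" by (simp add: R_def)
    next
      fix h h' assume h: "h \<in> ?P" "h' \<in> ?P" "h \<noteq> h'"
      let ?g = "h' \<otimes> inv h"
      have hc: "h \<in> carrier F" "h' \<in> carrier F" "\<psi> h z \<in> B" "\<psi> h' z \<in> B" using h by (auto simp: hits_def)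
      have "\<psi> ?g (\<psi> h z) = \<psi> h' z" using action_mult[of h' "inv h" "\<psi> h z"] hc action_inv by simp
      then have "?g \<notin> A - {\<one>}" using B(4) hc by metis
      moreover have "?g \<noteq> \<one>"
      proof
        assume "?g = \<one>"
        then have "gd h h' = 0" by (simp add: gd_def)
        then show False using h hc gd_eq_0 by simp
      qed
      ultimately show "R < gd h h'" using lenA[of ?g] hc by (simp add: gd_def)
    next
      fix h g assume h: "h \<in> ?P" and g: "g \<in> carrier F" "len g \<le> R"
      have hc: "h \<in> carrier F" "\<psi> h z \<in> B0" using h B by (auto simp: hits_def)
      have "\<psi> g (\<psi> h z) \<in> V \<longleftrightarrow> \<psi> g y \<in> V" using B0(4) lenA[OF g(1)] g hc y by blast
      then show "g \<otimes> h \<in> hits V z \<longleftrightarrow> g \<in> W0" using g hc by (simp add: hits_def W0_def action_mult)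
    qed
    ultimately show ?thesis by simp
  qed
  moreover have "\<exists>s\<in>S. \<exists>v\<in>V'. \<psi> s v \<in> U"
  proof -
    obtain w s where w: "w \<in> W'" "s \<in> S" "\<one> = s \<otimes> w" using W'(4) by (auto simp: mem_cov tile_def)
    have "\<psi> s (\<psi> w y) = y" using action_mult[of s w y] w W'c action_one by auto
    moreover have "\<psi> w y \<in> V'" using w B by (auto simp: V'_def)
    ultimately show ?thesis using w y B0 by force
  qed
  moreover have "V \<subseteq> V'" by (auto simp: V'_def)
  ultimately show ?thesis by (auto simp: tiler_def)
qed

lemma generic_tiling:
  obtains V where "open V" "disjoint_family_on (\<lambda>s. \<psi> s ` V) S"
    "closure (\<Union>s\<in>S. \<psi> s ` V) = UNIV"
proof -
  obtain \<B> :: "'x set set" where \<B>: "countable \<B>" "topological_basis \<B>" using ex_countable_basis by blast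
  define \<B>' where "\<B>' = \<B> - {{}}"
  have sub: "\<exists>B\<in>\<B>'. B \<subseteq> U" if "open U" "U \<noteq> {}" for U
    using topological_basisE[OF \<B>(2) that(1)] that(2) by (metis DiffI \<B>'_def empty_iff ex_in_conv singletonD)
  have "\<B>' \<noteq> {}" using sub[of UNIV] by auto
  define Bn where "Bn = from_nat_into \<B>'"
  have Bn: "range Bn = \<B>'" using \<open>\<B>' \<noteq> {}\<close> \<B>(1) by (simp add: Bn_def \<B>'_def range_from_nat_into)
  have Bo: "open (Bn n)" "Bn n \<noteq> {}" for n
    using Bn topological_basis_open[OF \<B>(2)] by (auto simp: \<B>'_def)
  have "\<exists>T. \<forall>n. tiler (snd (T n)) (fst (T n)) \<and> (fst (T n) \<subseteq> fst (T (Suc n)) \<and>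
      (\<exists>s\<in>S. \<exists>v\<in>fst (T (Suc n)). \<psi> s v \<in> Bn n))"
  proof (rule dependent_nat_choice)
    show "\<exists>T. tiler (snd T) (fst T)"
      by (intro exI[of _ "({}, 0)"]) (simp add: tiler_def hits_def good_empty)
    show "\<exists>T'. tiler (snd T') (fst T') \<and> (fst T \<subseteq> fst T' \<and> (\<exists>s\<in>S. \<exists>v\<in>fst T'. \<psi> s v \<in> Bn n))"
      if "tiler (snd T) (fst T)" for T n
      using tiler_extend[OF that Bo[of n]] by auto
  qed
  then obtain T where T: "\<And>n. tiler (snd (T n)) (fst (T n))" "\<And>n. fst (T n) \<subseteq> fst (T (Suc n))"
    "\<And>n. \<exists>s\<in>S. \<exists>v\<in>fst (T (Suc n)). \<psi> s v \<in> Bn n" by blast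
  have mono: "fst (T n) \<subseteq> fst (T k)" if "n \<le> k" for n k using lift_Suc_mono_le[of "\<lambda>n. fst (T n)"] T(2) that by blast
  define V where "V = (\<Union>n. fst (T n))"
  have "open V" using T(1) by (auto simp: V_def tiler_def)
  moreover have "\<psi> s ` V \<inter> \<psi> s' ` V = {}" if s: "s \<in> S" "s' \<in> S" "s \<noteq> s'" for s s'
  proof (rule ccontr)
    assume "\<psi> s ` V \<inter> \<psi> s' ` V \<noteq> {}"
    then obtain v v' where v: "v \<in> V" "v' \<in> V" "\<psi> s v = \<psi> s' v'" by blast
    obtain n k where "v \<in> fst (T n)" "v' \<in> fst (T k)" using v by (auto simp: V_def)
    then have vm: "v \<in> fst (T (max n k))" "v' \<in> fst (T (max n k))"
      using mono[of n "max n k"] mono[of k "max n k"] by auto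
    \<comment> \<open>An overlap of \<open>\<psi> s\<close> and \<open>\<psi> s'\<close> images
      means that, on the orbit of \<open>v\<close>, the tiles based at the identity and at
      \<open>g\<close> share the point \<open>s\<close>.\<close>
    define g where "g = inv s' \<otimes> s"
    have g: "g \<in> carrier F" "s' \<otimes> g = s" using s by (auto simp: g_def m_assoc[symmetric])
    have "\<psi> g v = \<psi> (inv s') (\<psi> s v)" using action_mult s by (simp add: g_def)
    also have "\<dots> = v'" using v action_inv s by simp
    finally have "\<one> \<in> hits (fst (T (max n k))) v" "g \<in> hits (fst (T (max n k))) v"
      using vm g by (auto simp: hits_def action_one)
    moreover have "s \<in> tile \<one>" "s \<in> tile g"
      using s g by (auto simp: tile_def intro: image_eqI[of _ _ s] image_eqI[of _ _ s'])
    moreover have "packed (hits (fst (T (max n k))) v)" using T(1) goodD(1) by (auto simp: tiler_def)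
    ultimately have "\<one> = g" using packedD by blast
    then have "s' = s" using g(2) s by (metis S_closed r_one)
    then show False using s by simp
  qed
  moreover have "closure (\<Union>s\<in>S. \<psi> s ` V) = UNIV"
  proof (rule ccontr)
    assume "closure (\<Union>s\<in>S. \<psi> s ` V) \<noteq> UNIV"
    then obtain B where B: "B \<in> \<B>'" "B \<subseteq> - closure (\<Union>s\<in>S. \<psi> s ` V)"
      using sub[of "- closure (\<Union>s\<in>S. \<psi> s ` V)"] by auto
    obtain n where "B = Bn n" using Bn B(1) by blast
    then obtain s v where "s \<in> S" "v \<in> fst (T (Suc n))" "\<psi> s v \<in> B" using T(3) by blast
    moreover from this have "\<psi> s v \<in> closure (\<Union>s\<in>S. \<psi> s ` V)"
      by (intro subsetD[OF closure_subset]) (auto simp: V_def)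
    ultimately show False using B(2) by blast
  qed
  ultimately show thesis using that by (simp add: disjoint_family_on_def)
qed

end

section \<open>Embedding a free group into a free group on two generators\<close>

locale free_pair = dom: free_basis F I f + cod: free_basis G B "\<lambda>b. b"
  for F :: "('f, 'b) monoid_scheme" and I :: "nat set" and f :: "nat \<Rightarrow> 'f"
    and G :: "('g, 'c) monoid_scheme" and B :: "'g set" +
  fixes a b :: 'g
  assumes ab: "a \<in> B" "b \<in> B" "a \<noteq> b"
begin

text \<open>The generator \<open>f i\<close> is sent to \<open>a^i b a^-i\<close>, a classical free
  family; natural indices serve directly as exponents.\<close>

definition conj_word :: "nat \<times> bool \<Rightarrow> ('g \<times> bool) list" where
  "conj_word l = replicate (fst l) (a, True) @ (b, snd l) # replicate (fst l) (a, False)"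

definition word_image :: "(nat \<times> bool) list \<Rightarrow> 'g" where
  "word_image w = foldr (\<lambda>l y. cod.val (conj_word l) \<otimes>\<^bsub>G\<^esub> y) w \<one>\<^bsub>G\<^esub>"

definition emb :: "'f \<Rightarrow> 'g" where "emb x = word_image (dom.nf x)"

lemma conj_word_closed: "fst ` set (conj_word l) \<subseteq> B"
  using ab by (auto simp: conj_word_def)

lemma val_conj_word_closed [simp]: "cod.val (conj_word l) \<in> carrier G"
  using conj_word_closed by (rule cod.val_closed)

lemma word_image_simps [simp]:
  "word_image [] = \<one>\<^bsub>G\<^esub>" "word_image (l # w) = cod.val (conj_word l) \<otimes>\<^bsub>G\<^esub> word_image w"
  by (auto simp: word_image_def)

lemma word_image_closed [simp]: "word_image w \<in> carrier G"
  by (induction w) auto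

lemma conj_word_inv: "cod.val (conj_word (inv_letter l)) = inv\<^bsub>G\<^esub> cod.val (conj_word l)"
proof -
  have "conj_word (inv_letter l) = map inv_letter (rev (conj_word l))"
    by (simp add: conj_word_def inv_letter_def)
  then show ?thesis using cod.val_inverse[OF conj_word_closed] by simp
qed

text \<open>Normal forms do not simply concatenate; when the new letter cancels the first one,
  \<open>conj_word_inv\<close> produces the same cancellation in \<open>G\<close>.\<close>

lemma emb_letter:
  assumes l: "fst l \<in> I" and y: "y \<in> carrier F"
  shows "emb (dom.act l \<otimes>\<^bsub>F\<^esub> y) = cod.val (conj_word l) \<otimes>\<^bsub>G\<^esub> emb y"
proof -
  have n: "dom.valid (dom.nf y)" "dom.val (dom.nf y) = y" using dom.nf y by auto
  show ?thesis
  proof (cases "dom.nf y \<noteq> [] \<and> hd (dom.nf y) = inv_letter l")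
    case True
    then obtain w where w: "dom.nf y = inv_letter l # w" by (cases "dom.nf y") auto
    then have v: "dom.valid w" using n by (simp add: dom.valid_Cons)
    have "y = inv\<^bsub>F\<^esub> dom.act l \<otimes>\<^bsub>F\<^esub> dom.val w" using n w l by (simp add: dom.act_inv_letter)
    then have "dom.act l \<otimes>\<^bsub>F\<^esub> y = dom.val w" using v l by (simp add: dom.m_assoc[symmetric])
    then have "emb (dom.act l \<otimes>\<^bsub>F\<^esub> y) = word_image w" using v by (simp add: emb_def dom.nf_val)
    then show ?thesis using w by (simp add: emb_def conj_word_inv cod.m_assoc[symmetric])
  next
    case False
    then have "dom.valid (l # dom.nf y)" using n l by (auto simp: dom.valid_Cons)
    then have "dom.nf (dom.val (l # dom.nf y)) = l # dom.nf y" by (rule dom.nf_val)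
    then show ?thesis using n by (simp add: emb_def)
  qed
qed

lemma emb_closed [simp]: "emb x \<in> carrier G"
  by (simp add: emb_def)

lemma emb_hom: "emb \<in> hom F G"
proof (rule homI)
  show "emb x \<in> carrier G" for x by simp
  fix x y assume x: "x \<in> carrier F" and y: "y \<in> carrier F"
  have "emb (dom.val w \<otimes>\<^bsub>F\<^esub> y) = word_image w \<otimes>\<^bsub>G\<^esub> emb y" if "fst ` set w \<subseteq> I" for w
    using that
  proof (induction w)
    case Nil
    then show ?case using y by (simp add: emb_def)
  next
    case (Cons l w)
    then have "dom.val w \<in> carrier F" by simp
    then have "emb (dom.val (l # w) \<otimes>\<^bsub>F\<^esub> y) = cod.val (conj_word l) \<otimes>\<^bsub>G\<^esub> emb (dom.val w \<otimes>\<^bsub>F\<^esub> y)"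
      using Cons.prems y by (simp add: dom.m_assoc emb_letter)
    then show ?case using Cons by (simp add: cod.m_assoc)
  qed
  from this[of "dom.nf x"] show "emb (x \<otimes>\<^bsub>F\<^esub> y) = emb x \<otimes>\<^bsub>G\<^esub> emb y"
    using dom.nf[OF x] by (simp add: emb_def dom.valid_closed)
qed

lemma val_replicate_append:
  "fst l \<in> B \<Longrightarrow> fst ` set z \<subseteq> B \<Longrightarrow> cod.val (replicate k l @ z) = cod.lp l k (cod.val z)"
  by (subst cod.val_append) (auto simp: cod.val_replicate cod.lp_def)

text \<open>The powers of \<open>a\<close> between two conjugates cancel only partially, so each letter \<open>b\<close> survives.\<close>

lemma word_image_start:
  assumes "dom.valid (l # w)"
  shows "\<exists>u. cod.valid (replicate (fst l) (a, True) @ (b, snd l) # u) \<and>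
    word_image (l # w) = cod.val (replicate (fst l) (a, True) @ (b, snd l) # u)"
  using assms
proof (induction w arbitrary: l)
  case Nil
  have "cod.valid (conj_word l)"
    using ab cod.valid_replicate[of "(a, True)" "fst l"] cod.valid_replicate[of "(a, False)" "fst l"]
    by (auto simp: conj_word_def cod.valid_append cod.valid_Cons inv_letter_def)
  then show ?case by (intro exI[of _ "replicate (fst l) (a, False)"]) (simp add: conj_word_def)
next
  case (Cons l' w)
  have v: "fst l \<in> I" "dom.valid (l' # w)" "l' \<noteq> inv_letter l" using Cons.prems by (auto simp: dom.valid_Cons)
  obtain u where u: "cod.valid (replicate (fst l') (a, True) @ (b, snd l') # u)"
    "word_image (l' # w) = cod.val (replicate (fst l') (a, True) @ (b, snd l') # u)"
    using Cons.IH[OF v(2)] by blast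
  define z where "z = (b, snd l') # u"
  have zv: "cod.valid z" using u(1) by (auto simp: z_def cod.valid_append)
  then have z: "cod.valid z" "fst ` set z \<subseteq> B" "cod.val z \<in> carrier G"
    using cod.valid_closed by auto
  define i j where "i = fst l" and "j = fst l'"
  \<comment> \<open>The reduced form of \<open>a^(j - i)\<close>, which is all that remains between
    the two letters over \<open>b\<close>. It is empty for \<open>i = j\<close>; then these two
    letters have equal sign, because \<open>l'\<close> is not the inverse of
    \<open>l\<close>.\<close>
  define mid where "mid = (if i \<le> j then replicate (j - i) (a, True) else replicate (i - j) (a, False))"
  have mid_ab: "set mid \<subseteq> {(a, True), (a, False)}" by (auto simp: mid_def)
  have mid: "cod.val (mid @ z) = cod.lp (a, False) i (cod.lp (a, True) j (cod.val z))"
    using cod.lp_inv_less[of "(a, True)" "cod.val z" i j] cod.lp_inv_greater[of "(a, True)" "cod.val z" j i]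
      ab z by (auto simp: mid_def val_replicate_append inv_letter_def)
  have mc: "fst ` set (mid @ z) \<subseteq> B" using mid_ab z ab by auto
  have "word_image (l # l' # w) = cod.val (conj_word l @ replicate j (a, True) @ z)"
  proof -
    have "fst ` set (replicate j (a, True) @ z) \<subseteq> B" using z ab by auto
    then have "cod.val (conj_word l @ replicate j (a, True) @ z) =
        cod.val (conj_word l) \<otimes>\<^bsub>G\<^esub> cod.val (replicate j (a, True) @ z)"
      using cod.val_append[OF conj_word_closed] by blast
    moreover have "word_image (l' # w) = cod.val (replicate j (a, True) @ z)" using u(2) by (simp only: z_def j_def)
    ultimately show ?thesis by (simp only: word_image_simps)
  qed
  also have "\<dots> = cod.val (replicate i (a, True) @ (b, snd l) # mid @ z)"
  proof -
    have t: "fst (a, True) \<in> B" "fst (a, False) \<in> B" using ab by auto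
    have c: "fst ` set ((b, snd l) # mid @ z) \<subseteq> B" "fst ` set (replicate j (a, True) @ z) \<subseteq> B"
      "fst ` set ((b, snd l) # replicate i (a, False) @ replicate j (a, True) @ z) \<subseteq> B"
      using mc z ab by auto
    have "conj_word l @ replicate j (a, True) @ z =
        replicate i (a, True) @ (b, snd l) # replicate i (a, False) @ replicate j (a, True) @ z"
      by (simp add: conj_word_def i_def)
    then show ?thesis
      by (simp only: val_replicate_append[OF t(1) c(3)] val_replicate_append[OF t(1) c(1)]
          val_replicate_append[OF t(2) c(2)] val_replicate_append[OF t(1) z(2)] cod.val_Cons mid)
  qed
  finally have img: "word_image (l # l' # w) = cod.val (replicate i (a, True) @ (b, snd l) # mid @ z)" .
  have "cod.valid mid" using ab by (simp add: mid_def cod.valid_replicate)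
  then have "cod.valid (mid @ z)"
  proof (cases "mid = []")
    case False
    then have "last mid \<in> {(a, True), (a, False)}" using mid_ab last_in_set by blast
    then have "hd z \<noteq> inv_letter (last mid)" using ab by (auto simp: z_def inv_letter_def)
    then show ?thesis using \<open>cod.valid mid\<close> z by (simp add: cod.valid_append)
  qed (use z in simp)
  moreover have "hd (mid @ z) \<noteq> inv_letter (b, snd l)"
  proof (cases "i = j")
    case True
    then have "snd l = snd l'" using v(3) by (auto simp: i_def j_def inv_letter_def prod_eq_iff)
    then show ?thesis using True by (simp add: mid_def z_def inv_letter_def)
  next
    case False
    then have "mid \<noteq> []" by (simp add: mid_def)
    then have "hd mid \<in> {(a, True), (a, False)}" using mid_ab hd_in_set by blast
    then show ?thesis using \<open>mid \<noteq> []\<close> ab by (auto simp: inv_letter_def)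
  qed
  ultimately have "cod.valid ((b, snd l) # mid @ z)" using ab by (auto simp: cod.valid_Cons)
  then have "cod.valid (replicate i (a, True) @ (b, snd l) # mid @ z)"
    using ab cod.valid_replicate[of "(a, True)" i]
    by (auto simp: cod.valid_append inv_letter_def)
  then show ?case using img by (auto simp: i_def)
qed

lemma emb_trivial:
  assumes x: "x \<in> carrier F" "emb x = \<one>\<^bsub>G\<^esub>"
  shows "x = \<one>\<^bsub>F\<^esub>"
proof (cases "dom.nf x")
  case Nil
  then show ?thesis using dom.nf[OF x(1)] by simp
next
  case (Cons l w)
  then obtain u where u: "cod.valid (replicate (fst l) (a, True) @ (b, snd l) # u)"
    "emb x = cod.val (replicate (fst l) (a, True) @ (b, snd l) # u)"
    using word_image_start[of l w] dom.nf[OF x(1)] by (auto simp: emb_def)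
  then have "cod.len (emb x) > 0" using cod.len_val by simp
  then show ?thesis using x(2) by simp
qed

end

section \<open>Lines, connectedness and the action\<close>

lemma (in free_basis) int_pow_lp:
  assumes "i \<in> I" "g \<in> carrier F"
  shows "f i [^] (int k) \<otimes> g = lp (i, True) k g" "f i [^] (- int k) \<otimes> g = lp (i, False) k g"
  using assms act_inv_letter[of "(i, True)"]
  by (simp_all add: lp_def int_pow_int int_pow_neg_int nat_pow_inv act_def letter_def)

locale nat_shape = shape F I f S
  for F :: "('f, 'b) monoid_scheme" (structure) and I :: "nat set" and f :: "nat \<Rightarrow> 'f" and S :: "'f set"

text \<open>The extrema in \<open>line\<close> are the step counts \<open>fwd\<close> in the two
  directions, and the powers are distinct because \<open>k\<close> steps in one direction cover
  distance \<open>k\<close>.\<close>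

lemma (in nat_shape) card_line:
  assumes i: "i \<in> I" and g: "g \<in> S"
  shows "card (line F f S i g) = linelen (i, True) g"
proof -
  let ?A = "fwd (i, True) g" and ?B = "fwd (i, False) g"
  have inv: "inv_letter (i, True) = (i, False)" by (simp add: inv_letter_def)
  define e where "e j = f i [^] (j::int) \<otimes> g" for j
  have e: "e (int k) = lp (i, True) k g" "e (- int k) = lp (i, False) k g" for k
    using int_pow_lp i g by (auto simp: e_def)
  have pos: "e j \<in> S" if "0 \<le> j" "j \<le> int ?A" for j
    using e(1)[of "nat j"] fwd_in[of "(i, True)" g "nat j"] i g that by simp
  have neg: "e j \<in> S" if "j \<le> 0" "- int ?B \<le> j" for j
    using e(2)[of "nat (- j)"] fwd_in[of "(i, False)" g "nat (- j)"] i g that by simp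
  have out: "e (int ?A + 1) \<notin> S" "e (- int ?B - 1) \<notin> S"
  proof -
    have eq: "int ?A + 1 = int (Suc ?A)" "- int ?B - 1 = - int (Suc ?B)" by auto
    show "e (int ?A + 1) \<notin> S" "e (- int ?B - 1) \<notin> S"
      unfolding eq e using fwd_out[of "(i, True)" g] fwd_out[of "(i, False)" g] i g by auto
  qed
  have "(GREATEST k::int. 0 \<le> k \<and> (\<forall>j\<in>{0..k}. e j \<in> S)) = int ?A"
  proof (rule Greatest_equality)
    show "0 \<le> int ?A \<and> (\<forall>j\<in>{0..int ?A}. e j \<in> S)" using pos by auto
    fix k assume k: "0 \<le> k \<and> (\<forall>j\<in>{0..k}. e j \<in> S)"
    show "k \<le> int ?A"
    proof (rule ccontr)
      assume "\<not> k \<le> int ?A"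
      then have "int ?A + 1 \<in> {0..k}" by simp
      then show False using k out(1) by blast
    qed
  qed
  moreover have "(LEAST k::int. k \<le> 0 \<and> (\<forall>j\<in>{k..0}. e j \<in> S)) = - int ?B"
  proof (rule Least_equality)
    show "- int ?B \<le> 0 \<and> (\<forall>j\<in>{- int ?B..0}. e j \<in> S)" using neg by auto
    fix k assume k: "k \<le> 0 \<and> (\<forall>j\<in>{k..0}. e j \<in> S)"
    show "- int ?B \<le> k"
    proof (rule ccontr)
      assume "\<not> - int ?B \<le> k"
      then have "- int ?B - 1 \<in> {k..0}" by simp
      then show False using k out(2) by blast
    qed
  qed
  ultimately have "line F f S i g = e ` {- int ?B..int ?A}"
    by (simp add: line_def Let_def e_def)
  moreover have "inj_on e {- int ?B..int ?A}"
  proof -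
    have "e j \<noteq> e k" if "j < k" for j k
    proof
      assume eq: "e j = e k"
      have ec: "e j \<in> carrier F" using i g by (simp add: e_def)
      have "e k = f i [^] int (nat (k - j)) \<otimes> e j"
        using that i g by (simp add: e_def m_assoc[symmetric] int_pow_mult[symmetric])
      then have "e k = lp (i, True) (nat (k - j)) (e j)" by (simp only: int_pow_lp(1)[OF i ec])
      then have "gd (e j) (e k) = nat (k - j)" using gd_lp[of "(i, True)" "e j"] i ec by simp
      then show False using eq ec that by simp
    qed
    then show ?thesis by (metis inj_onI linorder_neqE)
  qed
  ultimately show ?thesis by (simp add: card_image linelen_def inv)
qed

locale nat_basis = free_basis F I f
  for F :: "('f, 'b) monoid_scheme" (structure) and I :: "nat set" and f :: "nat \<Rightarrow> 'f" +
  fixes m :: nat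
  assumes I: "I = {1..m}"
begin

abbreviation edge :: "'f \<Rightarrow> 'f \<Rightarrow> bool" where
  "edge x y \<equiv> \<exists>i\<in>I. y = f i \<otimes> x \<or> y = inv f i \<otimes> x"

lemma edge_act:
  assumes "fst l \<in> I" shows "edge x (act l \<otimes> x)"
  using assms by (intro bexI[of _ "fst l"]) (auto simp: act_def letter_def)

lemma gd_edge:
  assumes "edge x y" "x \<in> carrier F"
  shows "y \<in> carrier F \<and> gd x y = 1"
proof -
  obtain i where i: "i \<in> I" "y = f i \<otimes> x \<or> y = inv f i \<otimes> x" using assms(1) by blast
  then obtain l where l: "fst l = i" "y = act l \<otimes> x"
    by (auto simp: act_def letter_def intro: that[of "(i, True)"] that[of "(i, False)"])
  then show ?thesis using gd_lp[of l x 1] i assms(2) by (simp add: lp_1)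
qed

text \<open>A path lists its vertices, one more than its edges, hence the strict inequality. It
  gives the lower bound by which reduced walks are shortest paths.\<close>

lemma gd_path:
  assumes "q \<noteq> []" "hd q \<in> carrier F" "successively edge q"
  shows "last q \<in> carrier F \<and> gd (hd q) (last q) < length q"
  using assms
proof (induction q rule: induct_list012)
  case (3 x y q)
  have e: "edge x y" "x \<in> carrier F" using 3(4,5) by simp_all
  have y: "y \<in> carrier F" "gd x y = 1" using gd_edge[OF e] by blast+
  then have l: "last (y # q) \<in> carrier F" "gd y (last (y # q)) < length (y # q)" using 3 by auto
  have "gd x (last (y # q)) \<le> gd x y + gd y (last (y # q))" using gd_triangle l(1) y(1) 3(4) by simp
  then show ?case using y(2) l by simp
qed auto

lemma connected_cnvx:
  assumes con: "connected_subset F m f K" and K: "K \<subseteq> carrier F"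
  shows "cnvx K"
  unfolding cnvx_def
proof (intro conjI ballI)
  fix u v assume uv: "u \<in> K" "v \<in> K"
  then have c: "u \<in> carrier F" "v \<in> carrier F" using K by auto
  show "seg u v \<subseteq> K"
  proof (cases "u = v")
    case True
    then show ?thesis using uv c by simp
  next
    case False
    define n where "n = gd u v"
    obtain a where a: "ray a" "walk u a n = v" using ray_exists c False unfolding n_def by metis
    define q where "q = map (walk u a) [0..<Suc n]"
    have "successively edge (map (walk u a) [0..<Suc k])" for k
    proof (induction k)
      case (Suc k)
      have "edge (walk u a k) (walk u a (Suc k))" using edge_act[of "a k"] a(1) by (simp add: ray_def)
      moreover have "map (walk u a) [0..<Suc (Suc k)] = map (walk u a) [0..<Suc k] @ [walk u a (Suc k)]" by simp
      ultimately show ?case using Suc by (simp only: successively_append_iff) (simp add: last_map)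
    qed simp
    then have path: "is_path F m f u v q"
      using a(2) by (auto simp: is_path_def q_def hd_map last_map I[symmetric] simp del: upt_Suc One_nat_def)
    have "shortest_path F m f u v q"
      unfolding shortest_path_def
    proof (intro conjI allI impI path)
      fix q' assume "is_path F m f u v q'"
      then have "gd u v < length q'" using gd_path[of q'] c by (auto simp: is_path_def I[symmetric] simp del: One_nat_def)
      then show "length q \<le> length q'" by (simp add: q_def n_def)
    qed
    then have "set q \<subseteq> K" using con uv unfolding connected_subset_def by blast
    moreover have "seg u v \<subseteq> set q"
    proof
      fix z assume "z \<in> seg u v"
      then have "z \<in> seg (walk u a 0) (walk u a n)" using a(2) by simp
      then obtain k where "k \<le> n" "z = walk u a k" using seg_walk[OF a(1) c(1), of 0 n] by blast
      then show "z \<in> set q" unfolding q_def set_map by (intro image_eqI[of _ _ k]) auto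
    qed
    ultimately show ?thesis by blast
  qed
qed (use K in simp)

end

text \<open>Baire category theorem for the complete metric of the type. It yields points with free
  orbit in every nonempty open set.\<close>

lemma comeager_meets_open:
  fixes D :: "'x::polish_space set"
  assumes D: "comeager D" and U: "open U" "U \<noteq> {}"
  obtains y where "y \<in> U" "y \<in> D"
proof -
  obtain \<U> where \<U>: "countable \<U>" "\<And>W. W \<in> \<U> \<Longrightarrow> open W \<and> closure W = UNIV" "\<Inter>\<U> \<subseteq> D"
    using D unfolding comeager_def by blast
  have "Met_TC.mtopology closure_of \<Inter>\<U> = UNIV"
    using \<U> complete_UNIV by (intro Met_TC.metric_Baire_category) auto
  then have "closure (\<Inter>\<U>) = UNIV" by simp
  then have "U \<inter> \<Inter>\<U> \<noteq> {}" using open_Int_closure_eq_empty[OF U(1), of "\<Inter>\<U>"] U(2) by auto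
  then show thesis using that \<U>(3) by blast
qed

theorem theorem4p3:
  fixes r m :: nat
    and sys :: "congruence_spec list"
    and F :: "'f monoid" and f :: "nat \<Rightarrow> 'f" and S :: "nat \<Rightarrow> 'f set"
    and G :: "'g monoid" and \<phi> :: "'g \<Rightarrow> 'x::polish_space \<Rightarrow> 'x"
  assumes "r \<ge> 1"
    and "congruence_system r sys"
    and "freely_generated F {1..m} f"
    and "\<forall>k\<in>{1..r}. S k \<subseteq> carrier F \<and> finite (S k) \<and> S k \<noteq> {}"
    and "satisfies F (\<lambda>g x. g \<otimes>\<^bsub>F\<^esub> x) r sys S"
    and "connected_subset F m f (\<Union>k\<in>{1..r}. S k)"
    and "prime_subset F m f (\<Union>k\<in>{1..r}. S k)"
    and "suitable_space G \<phi>"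
  shows "\<exists>A. (\<forall>k\<in>{1..r}. open (A k) \<and> A k \<noteq> {}) \<and>
             satisfies G \<phi> r sys A \<and>
             closure (\<Union>k\<in>{1..r}. A k) = UNIV"
proof -
  obtain B a b where B: "freely_generated G B (\<lambda>b. b)" "a \<in> B" "b \<in> B" "a \<noteq> b"
    using assms(8) unfolding suitable_space_def by blast
  obtain D where D: "comeager D" "\<And>x g. x \<in> D \<Longrightarrow> g \<in> carrier G \<Longrightarrow> g \<noteq> \<one>\<^bsub>G\<^esub> \<Longrightarrow> \<phi> g x \<noteq> x"
    using assms(8) unfolding suitable_space_def by blast
  have act: "group_action G UNIV \<phi>" and hom: "\<And>g. g \<in> carrier G \<Longrightarrow> \<exists>\<psi>. homeomorphism UNIV UNIV (\<phi> g) \<psi>"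
    using assms(8) unfolding suitable_space_def by blast+
  define I where "I = {1..m}"
  interpret nat_basis F I f m using assms(3) by unfold_locales (auto simp: I_def)
  interpret free_pair F I f G B a b using B by unfold_locales
  define T where "T = (\<Union>k\<in>{1..r}. S k)"
  have Tc: "T \<subseteq> carrier F" "finite T" "T \<noteq> {}" using assms(1,4) by (auto simp: T_def)
  have "cnvx T" using connected_cnvx[of T] assms(6) Tc by (simp add: T_def)
  moreover have "finite I" by (simp add: I_def)
  ultimately interpret nat_shape F I f T using Tc by unfold_locales
  have "\<exists>N. \<forall>n\<ge>N. n \<in> lengths (i, True)" if i: "i \<in> I" for i
  proof -
    obtain s where s: "s \<in> T" using Tc by blast
    have "\<exists>q\<in>linelen (i, True) ` T. \<not> d dvd q" if "d > 1" for d
      using assms(7) i that card_line[OF i] unfolding prime_subset_def T_def[symmetric] I_def[symmetric] by force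
    moreover have "linelen (i, True) s > 0" by (simp add: linelen_def)
    ultimately obtain N where "\<And>n. n \<ge> N \<Longrightarrow> n \<in> {sum_list ns | ns. set ns \<subseteq> linelen (i, True) ` T}"
      using sums_cofinite[of "linelen (i, True) s" "linelen (i, True) ` T"] s by blast
    then show ?thesis unfolding lengths_def by blast
  qed
  then obtain N where N: "\<And>i n. i \<in> I \<Longrightarrow> n \<ge> N i \<Longrightarrow> n \<in> lengths (i, True)" by metis
  \<comment> \<open>The sum is a convenient common upper bound for the finitely many
    thresholds.\<close>
  define N0 where "N0 = (\<Sum>i\<in>I. N i)"
  have N0: "n \<in> lengths l" if l: "fst l \<in> I" "n \<ge> N0" for l n
  proof -
    have "N (fst l) \<le> N0" unfolding N0_def using l finite_I by (intro member_le_sum) auto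
    then have "n \<in> lengths (fst l, True)" using N l by simp
    moreover have "linelen l = linelen (fst l, True)"
      using linelen_inv_letter[of "(fst l, True)"] by (cases l; cases "snd l") (auto simp: inv_letter_def)
    ultimately show ?thesis by (simp add: lengths_def)
  qed
  define \<psi> where "\<psi> g = \<phi> (emb g)" for g
  have emb_mult: "emb (g \<otimes>\<^bsub>F\<^esub> h) = emb g \<otimes>\<^bsub>G\<^esub> emb h" if "g \<in> carrier F" "h \<in> carrier F" for g h
    using emb_hom that by (rule hom_mult)
  have \<psi>_mult: "\<psi> (g \<otimes>\<^bsub>F\<^esub> h) z = \<psi> g (\<psi> h z)" if "g \<in> carrier F" "h \<in> carrier F" for g h z
    using group_action.composition_rule[OF act, of z "emb g" "emb h"] emb_mult that by (simp add: \<psi>_def)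
  interpret tiling_action F I f T N0 \<psi>
  proof unfold_locales
    show "fst l \<in> I \<Longrightarrow> N0 \<le> n \<Longrightarrow> n \<in> lengths l" for l n using N0 .
    show "\<psi> \<one>\<^bsub>F\<^esub> z = z" for z
      using group_action.id_eq_one[OF act] hom_one[OF emb_hom is_group cod.is_group]
      by (simp add: \<psi>_def fun_eq_iff)
    show "\<psi> (g \<otimes>\<^bsub>F\<^esub> h) z = \<psi> g (\<psi> h z)" if "g \<in> carrier F" "h \<in> carrier F" for g h z
      using \<psi>_mult that .
    show "continuous_on UNIV (\<psi> g)" for g
      using hom[of "emb g"] by (auto simp: \<psi>_def homeomorphism_def)
    show "\<exists>y\<in>U. \<forall>g\<in>carrier F. g \<noteq> \<one>\<^bsub>F\<^esub> \<longrightarrow> \<psi> g y \<noteq> y" if U: "open U" "U \<noteq> {}" for U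
    proof -
      obtain y where y: "y \<in> U" "y \<in> D" by (rule comeager_meets_open[OF D(1) U])
      have "\<psi> g y \<noteq> y" if "g \<in> carrier F" "g \<noteq> \<one>\<^bsub>F\<^esub>" for g
        using D(2)[OF y(2), of "emb g"] emb_trivial[of g] that by (auto simp: \<psi>_def)
      then show ?thesis using y(1) by blast
    qed
  qed
  obtain V where V: "open V" "disjoint_family_on (\<lambda>s. \<psi> s ` V) T"
    "closure (\<Union>s\<in>T. \<psi> s ` V) = UNIV" by (rule generic_tiling)
  define A where "A k = (\<Union>s\<in>S k. \<psi> s ` V)" for k
  have "V \<noteq> {}" using V(3) by force
  have ST: "s \<in> T" if "s \<in> S k" "k \<in> {1..r}" for s k using that unfolding T_def by blast
  then have Sc: "s \<in> T" "s \<in> carrier F" if "s \<in> S k" "k \<in> {1..r}" for s k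
    using that Tc(1) by blast+
  have "open (A k) \<and> A k \<noteq> {}" if k: "k \<in> {1..r}" for k
  proof
    show "open (A k)" unfolding A_def by (intro open_UN ballI action_open V(1) Sc(2)[OF _ k])
    have "S k \<noteq> {}" using assms(4) k by blast
    then show "A k \<noteq> {}" using \<open>V \<noteq> {}\<close> by (auto simp: A_def)
  qed
  moreover have "A j \<inter> A k = {}" if jk: "j \<in> {1..r}" "k \<in> {1..r}" "j \<noteq> k" for j k
  proof -
    have "S j \<inter> S k = {}" using assms(5) jk unfolding satisfies_def by blast
    have "\<psi> s ` V \<inter> \<psi> s' ` V = {}" if s: "s \<in> S j" "s' \<in> S k" for s s'
    proof -
      have "s \<noteq> s'" using \<open>S j \<inter> S k = {}\<close> s by auto
      then show ?thesis using disjoint_family_onD[OF V(2) Sc(1)[OF s(1) jk(1)] Sc(1)[OF s(2) jk(2)]] by simp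
    qed
    then show ?thesis by (simp add: A_def Int_UN_distrib2)
  qed
  moreover have "\<exists>\<sigma>\<in>carrier G. \<phi> \<sigma> ` (\<Union>k\<in>L. A k) = (\<Union>k\<in>R. A k)" if LR: "(L, R) \<in> set sys" for L R
  proof -
    obtain \<sigma> where \<sigma>: "\<sigma> \<in> carrier F" "(\<lambda>x. \<sigma> \<otimes>\<^bsub>F\<^esub> x) ` (\<Union>k\<in>L. S k) = (\<Union>k\<in>R. S k)"
      using bspec[OF conjunct2[OF assms(5)[unfolded satisfies_def]] LR] by auto
    have L: "L \<subseteq> {1..r}" using bspec[OF assms(2)[unfolded congruence_system_def] LR] by simp
    have \<psi>\<sigma>: "\<psi> \<sigma> ` \<psi> s ` V = \<psi> (\<sigma> \<otimes>\<^bsub>F\<^esub> s) ` V" if s: "s \<in> (\<Union>k\<in>L. S k)" for s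
    proof -
      obtain k where "k \<in> L" "s \<in> S k" using s by (rule UN_E)
      then have "s \<in> carrier F" using Sc(2)[of s k] subsetD[OF L, of k] by simp
      then show ?thesis using \<psi>_mult[OF \<sigma>(1)] by (simp add: image_image)
    qed
    have "\<psi> \<sigma> ` (\<Union>k\<in>L. A k) = (\<Union>s\<in>(\<Union>k\<in>L. S k). \<psi> \<sigma> ` \<psi> s ` V)"
      by (auto simp: A_def)
    also have "\<dots> = (\<Union>s\<in>(\<Union>k\<in>L. S k). \<psi> (\<sigma> \<otimes>\<^bsub>F\<^esub> s) ` V)" using \<psi>\<sigma> by (intro SUP_cong) auto
    also have "\<dots> = (\<Union>t\<in>(\<lambda>x. \<sigma> \<otimes>\<^bsub>F\<^esub> x) ` (\<Union>k\<in>L. S k). \<psi> t ` V)" by simp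
    also have "\<dots> = (\<Union>k\<in>R. A k)" by (simp only: \<sigma>(2) A_def UN_UN_flatten)
    finally show ?thesis unfolding \<psi>_def by (intro bexI[of _ "emb \<sigma>"]) auto
  qed
  moreover have "(\<Union>k\<in>{1..r}. A k) = (\<Union>s\<in>T. \<psi> s ` V)" by (auto simp: A_def T_def)
  ultimately show ?thesis using V(3) by (intro exI[of _ A]) (auto simp: satisfies_def)
qed

end
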